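(* Let $n \geq 1$. For every integer $g \geq 0$, the number of primitive factorizations of the full cycle $(1\,2\,\dots\,n) \in S(n)$ into $n-1+2g$ transpositions equals $$\operatorname{Cat}_{n-1} \cdot T(n-1+g, n-1).$$ Equivalently, if $a_k$ denotes the number of primitive factorizations of $(1\,2\,\dots\,n)$ into $k$ transpositions, then $$\sum_{k\ge 0} a_k z^k = \frac{\operatorname{Cat}_{n-1} z^{n-1}}{(1-1^2z^2)(1-2^2z^2)\cdots(1-(n-1)^2z^2)}$$ as formal power series in $z$.
   Context: A factorization $\pi = (s_1,t_1)\cdots(s_k,t_k)$ of $\pi \in S(n)$ into $k$ transpositions, written with $s_i<t_i$, is called primitive if $2 \leq t_1 \leq t_2 \leq \dots \leq t_k \leq n$. $\operatorname{Cat}_m = \frac{1}{m+1}\binom{2m}{m}$ is the Catalan number. The Carlitz–Riordan central factorial numbers are defined by $T(m+g, m) = h_g(1^2, 2^2, \dots, m^2)$ for $m, g \geq 0$, where $h_g$ is the complete homogeneous symmetric polynomial of degree $g$ (so $T(g,0)=1$ if $g=0$ and $0$ otherwise); equivalently $\sum_{g\ge0} T(m+g,m)u^g = \prod_{i=1}^m (1-i^2u)^{-1}$. *)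

theory Defs
  imports
    "HOL-Combinatorics.Combinatorics"
    "HOL-Computational_Algebra.Formal_Power_Series"
begin

text \<open>
  Elements of $S(n)$ are functions permuting \<open>{1..n}\<close>. A factorization is the list of pairs
  \<open>(s, t)\<close> with \<open>s < t\<close> standing for its transpositions; \<open>apply_transps\<close> multiplies
  them as functions, so the rightmost transposition acts first. As in the literature, two
  factorizations are different if they differ as sequences.
\<close>

definition transposition_factorizations ::
  "nat \<Rightarrow> (nat \<Rightarrow> nat) \<Rightarrow> nat \<Rightarrow> (nat \<times> nat) list set"
  where "transposition_factorizations n \<pi> k =
    {ts. length ts = k \<and> (\<forall>(s, t) \<in> set ts. 1 \<le> s \<and> s < t \<and> t \<le> n) \<and> apply_transps ts = \<pi>}"

definition primitive_factorizations ::
  "nat \<Rightarrow> (nat \<Rightarrow> nat) \<Rightarrow> nat \<Rightarrow> (nat \<times> nat) list set"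
  where "primitive_factorizations n \<pi> k =
    {ts \<in> transposition_factorizations n \<pi> k. sorted (map snd ts)}"

lemma finite_primitive_factorizations: "finite (primitive_factorizations n \<pi> k)"
proof (rule finite_subset)
  show "primitive_factorizations n \<pi> k \<subseteq> {ts. set ts \<subseteq> {1..n} \<times> {1..n} \<and> length ts = k}"
    by (fastforce simp: primitive_factorizations_def transposition_factorizations_def)
qed (simp add: finite_lists_length_eq)

definition full_cycle :: "nat \<Rightarrow> nat \<Rightarrow> nat"
  where "full_cycle n = cycle_of_list [1..<Suc n]"

lemma full_cycle_permutes: "full_cycle n permutes {1..n}"
  using cycle_permutes[of "[1..<Suc n]"]
  by (simp add: full_cycle_def atLeastLessThanSuc_atLeastAtMost del: upt_Suc)

lemma full_cycle_apply:
  assumes "i \<in> {1..n}"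
  shows "full_cycle n i = (if i = n then 1 else Suc i)"
proof -
  let ?cs = "[1..<Suc n]"
  have i: "i - 1 < length ?cs" "?cs ! (i - 1) = i"
    using assms by (auto simp del: upt_Suc)
  have "map (full_cycle n) ?cs = rotate1 ?cs"
    using cyclic_rotation[of ?cs 1] by (simp add: full_cycle_def del: upt_Suc)
  hence "full_cycle n i = rotate1 ?cs ! (i - 1)"
    using i by (metis nth_map)
  also have "\<dots> = ?cs ! (Suc (i - 1) mod length ?cs)"
    using i(1) by (rule nth_rotate1)
  also have "\<dots> = (if i = n then 1 else Suc i)"
    using assms by (auto simp del: upt_Suc)
  finally show ?thesis .
qed

definition catalan :: "nat \<Rightarrow> rat"
  where "catalan m = 1 / of_nat (m + 1) * of_nat ((2 * m) choose m)"

text \<open>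
  The complete homogeneous symmetric polynomial $h_g(x_1, \dots, x_m)$: its monomials of degree
  \<open>g\<close> correspond to the weakly increasing index sequences of length \<open>g\<close> in \<open>{1..m}\<close>.
\<close>

definition complete_homogeneous :: "nat \<Rightarrow> nat \<Rightarrow> (nat \<Rightarrow> 'a::comm_semiring_1) \<Rightarrow> 'a"
  where "complete_homogeneous g m x =
    (\<Sum>js | length js = g \<and> sorted js \<and> set js \<subseteq> {1..m}. prod_list (map x js))"

text \<open>Off the defining range \<open>m \<le> N\<close>, where $N = m + g$, the value is set to 0.\<close>

definition central_factorial :: "nat \<Rightarrow> nat \<Rightarrow> nat"
  where "central_factorial N m =
    (if m \<le> N then complete_homogeneous (N - m) m (\<lambda>i. i ^ 2) else 0)"

end

(*
  Write J_j = (1 j) + ... + (j-1 j) for the Jucys-Murphy elements. Splitting off the last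
  transposition shows that a_k(pi), the number of primitive factorizations of pi into k
  transpositions, is the coefficient of pi in h_k(J_2, ..., J_n). This element is central, so
  a_k is constant on long cycles, and only the hook characters see long cycles. Their generating
  function is det(1 - x pi) / (1 - x) = prod_cycles (1 - x^length) / (1 - x). Multiplication by
  J_n acts on it through cutting and joining the cycle of n, and the result diagonalizes into two
  parts on which J_n acts by the content of the box containing n. Induction on n then gives
    n! sum_k a_k z^k = sum_r (-1)^r binom(n-1, r) prod_{c = -r}^{n-1-r} (1 - c z)^{-1},
  and the Chu-Vandermonde identity evaluates the right-hand side.
*)
theory Submission
  imports Defs "HOL-Computational_Algebra.Polynomial"
begin

section \<open>Counting primitive factorizations\<close>

text \<open>All hooks are kept together in one polynomial in x: its coefficient at x^r is (-1)^r
  times the character of the r-th hook, so summing over r is evaluating at x = 1. There the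
  polynomial of a permutation is n for a long cycle and 0 otherwise; the (n-1)! long cycles are
  conjugate and hence counted alike, which is the origin of the factor n!. Keeping x also turns
  contents into a differential operator: J_n acts as n - 1 - x d/dx on the arm part and as -x d/dx
  on the leg part, and x^r is an eigenvector of x d/dx. The two parts are obtained by solving for
  such a decomposition, so that characters enter only through the explicit polynomial and no
  representation has to be constructed. For the final evaluation all hooks are put over the common
  denominator with contents -(n-1), ..., n-1; the contents that a hook lacks form two falling
  factorials of step z, whose arguments add up to 2(n-1)z.\<close>

lemma primitive_factorizations_Suc:
  "primitive_factorizations (Suc m) \<pi> (Suc k) =
     primitive_factorizations m \<pi> (Suc k) \<union>
     (\<Union>s\<in>{1..m}. (\<lambda>ts. ts @ [(s, Suc m)]) `
        primitive_factorizations (Suc m) (\<pi> \<circ> transpose s (Suc m)) k)"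
    (is "?L = ?M \<union> ?R")
proof (intro equalityI subsetI)
  fix ts assume ts: "ts \<in> ?L"
  then have len: "length ts = Suc k"
    and pairs: "\<forall>(s, t)\<in>set ts. 1 \<le> s \<and> s < t \<and> t \<le> Suc m"
    and comp: "apply_transps ts = \<pi>" and srt: "sorted (map snd ts)"
    by (auto simp: primitive_factorizations_def transposition_factorizations_def)
  from len obtain us p where us: "ts = us @ [p]" "length us = k"
    by (cases ts rule: rev_cases) auto
  obtain s t where p: "p = (s, t)"
    by fastforce
  show "ts \<in> ?M \<union> ?R"
  proof (cases "t = Suc m")
    case True
    have "apply_transps us = \<pi> \<circ> transpose s (Suc m)"
      using comp by (auto simp: us p True comp_assoc)
    then have "us \<in> primitive_factorizations (Suc m) (\<pi> \<circ> transpose s (Suc m)) k"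
      using us pairs srt
      by (auto simp: primitive_factorizations_def transposition_factorizations_def sorted_append)
    moreover have "s \<in> {1..m}"
      using pairs by (auto simp: us p True)
    ultimately show ?thesis
      by (auto simp: us p True)
  next
    case False
    then have "t \<le> m"
      using pairs by (auto simp: us p)
    \<comment> \<open>Sortedness puts the largest t last, so all of them are at most m.\<close>
    then have "\<forall>q\<in>set ts. snd q \<le> m"
      using srt by (force simp: us p sorted_append)
    then have "ts \<in> ?M"
      using pairs len comp srt
      by (auto simp: primitive_factorizations_def transposition_factorizations_def)
    then show ?thesis ..
  qed
next
  fix ts assume "ts \<in> ?M \<union> ?R"
  then consider "ts \<in> ?M"
    | s us where "s \<in> {1..m}" "ts = us @ [(s, Suc m)]"
        "us \<in> primitive_factorizations (Suc m) (\<pi> \<circ> transpose s (Suc m)) k"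
    by blast
  then show "ts \<in> ?L"
  proof cases
    case 1
    then show ?thesis
      by (auto simp: primitive_factorizations_def transposition_factorizations_def)
  next
    case 2
    then have "apply_transps ts = \<pi>"
      by (simp add: primitive_factorizations_def transposition_factorizations_def comp_assoc)
    with 2 show ?thesis
      by (auto simp: primitive_factorizations_def transposition_factorizations_def sorted_append)
  qed
qed

text \<open>Rational values permit the subtraction in the conjugation argument and the use as
  scalars on \<open>rat poly\<close>.\<close>

definition prim_count :: "nat \<Rightarrow> nat \<Rightarrow> (nat \<Rightarrow> nat) \<Rightarrow> rat"
  where "prim_count n k \<pi> = of_nat (card (primitive_factorizations n \<pi> k))"

lemma prim_count_0: "prim_count n 0 \<pi> = (if \<pi> = id then 1 else 0)"
proof -
  have "primitive_factorizations n \<pi> 0 = (if \<pi> = id then {[]} else {})"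
    by (auto simp: primitive_factorizations_def transposition_factorizations_def)
  then show ?thesis
    by (simp add: prim_count_def)
qed

text \<open>Coefficient form of h_{k+1}(J_2, ..., J_{m+1}) = h_{k+1}(J_2, ..., J_m) + h_k(J_2, ...,
  J_{m+1}) J_{m+1}.\<close>

lemma prim_count_Suc:
  "prim_count (Suc m) (Suc k) \<pi> =
     prim_count m (Suc k) \<pi> + (\<Sum>s\<in>{1..m}. prim_count (Suc m) k (\<pi> \<circ> transpose s (Suc m)))"
proof -
  let ?F = "\<lambda>s. (\<lambda>ts. ts @ [(s, Suc m)]) `
        primitive_factorizations (Suc m) (\<pi> \<circ> transpose s (Suc m)) k"
  have "card (primitive_factorizations (Suc m) \<pi> (Suc k)) =
      card (primitive_factorizations m \<pi> (Suc k)) + card (\<Union>s\<in>{1..m}. ?F s)"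
    unfolding primitive_factorizations_Suc
  proof (rule card_Un_disjoint)
    have "ts \<notin> primitive_factorizations m \<pi> (Suc k)" if "ts \<in> ?F s" for ts s
      using that unfolding primitive_factorizations_def transposition_factorizations_def by auto
    then show "primitive_factorizations m \<pi> (Suc k) \<inter> (\<Union>s\<in>{1..m}. ?F s) = {}"
      by blast
  qed (simp_all add: finite_primitive_factorizations)
  also have "card (\<Union>s\<in>{1..m}. ?F s) = (\<Sum>s\<in>{1..m}. card (?F s))"
    by (rule card_UN_disjoint) (simp_all add: finite_primitive_factorizations, blast)
  also have "\<dots> = (\<Sum>s\<in>{1..m}.
      card (primitive_factorizations (Suc m) (\<pi> \<circ> transpose s (Suc m)) k))"
    by (intro sum.cong card_image) (auto simp: inj_on_def)
  finally show ?thesis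
    by (simp add: prim_count_def)
qed

lemma primitive_factorization_permutes:
  assumes "ts \<in> primitive_factorizations n \<pi> k"
  shows "\<pi> permutes {1..n}"
proof -
  have ts: "apply_transps ts = \<pi>" "\<forall>(s, t)\<in>set ts. 1 \<le> s \<and> s < t \<and> t \<le> n"
    using assms by (simp_all add: primitive_factorizations_def transposition_factorizations_def)
  have "apply_transps ts permutes {1..n}"
    using ts(2) by (intro permutes_apply_transps) auto
  then show ?thesis
    by (simp only: ts(1))
qed

lemma prim_count_eq_0:
  assumes "\<not> \<pi> permutes {1..n}"
  shows "prim_count n k \<pi> = 0"
proof -
  have "primitive_factorizations n \<pi> k = {}"
    using assms primitive_factorization_permutes by blast
  then show ?thesis
    by (simp add: prim_count_def)
qed

section \<open>Invariance of the counts under conjugation\<close>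

lemma transpose_conj_id_iff:
  "transpose a b \<circ> \<pi> \<circ> transpose a b = id \<longleftrightarrow> \<pi> = id"
proof
  assume "transpose a b \<circ> \<pi> \<circ> transpose a b = id"
  then have "transpose a b \<circ> (transpose a b \<circ> \<pi> \<circ> transpose a b) \<circ> transpose a b =
      transpose a b \<circ> id \<circ> transpose a b"
    by (simp only:)
  then show "\<pi> = id"
    by (simp add: fun_eq_iff)
qed simp

text \<open>A permutation of {1..m} fixes both points moved by \<sigma> and so commutes with it. If
  neither \<pi> nor its conjugate permutes {1..m}, both counts are 0.\<close>

lemma prim_count_conj_disjoint:
  assumes "m < i"
  defines "\<sigma> \<equiv> transpose i (Suc i)"
  shows "prim_count m k (\<sigma> \<circ> \<pi> \<circ> \<sigma>) = prim_count m k \<pi>"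
proof -
  have comm: "\<sigma> \<circ> \<rho> \<circ> \<sigma> = \<rho>" if "\<rho> permutes {1..m}" for \<rho>
  proof -
    have "\<rho> i = i" "\<rho> (Suc i) = Suc i"
      using that assms(1) by (auto simp: permutes_def)
    moreover have "inj \<rho>"
      using that by (rule permutes_inj)
    ultimately show ?thesis
      by (auto simp: fun_eq_iff \<sigma>_def transpose_def inj_eq) (metis inj_eq)+
  qed
  have "\<pi> = \<sigma> \<circ> (\<sigma> \<circ> \<pi> \<circ> \<sigma>) \<circ> \<sigma>"
    by (simp add: fun_eq_iff \<sigma>_def)
  then show ?thesis
    using comm prim_count_eq_0 by metis
qed

text \<open>
  For functions \<open>\<phi>\<close> on permutations, \<open>jm m \<phi>\<close> is the action of the Jucys--Murphy element
  $(1\,n) + \dots + (n-1\,n)$ with $n = m + 1$, by multiplication from the right.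
\<close>

definition jm :: "nat \<Rightarrow> ((nat \<Rightarrow> nat) \<Rightarrow> 'a::comm_monoid_add) \<Rightarrow> (nat \<Rightarrow> nat) \<Rightarrow> 'a"
  where "jm m \<phi> \<pi> = (\<Sum>s\<in>{1..m}. \<phi> (\<pi> \<circ> transpose s (Suc m)))"

lemma prim_count_Suc_jm:
  "prim_count (Suc m) (Suc k) \<pi> = prim_count m (Suc k) \<pi> + jm m (prim_count (Suc m) k) \<pi>"
  by (simp add: prim_count_Suc jm_def)

text \<open>Here \<sigma> fixes \<open>Suc m\<close> and permutes {1..m}, so conjugation by it only
  permutes the summands of J_{m+1}.\<close>

lemma jm_conj_lower:
  assumes i: "1 \<le> i" "i < m"
  defines "\<sigma> \<equiv> transpose i (Suc i)"
  assumes \<phi>: "\<And>\<pi>. \<phi> (\<sigma> \<circ> \<pi> \<circ> \<sigma>) = \<phi> \<pi>"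
  shows "jm m \<phi> (\<sigma> \<circ> \<pi> \<circ> \<sigma>) = jm m \<phi> \<pi>"
proof -
  have "jm m \<phi> (\<sigma> \<circ> \<pi> \<circ> \<sigma>) = (\<Sum>s\<in>{1..m}. \<phi> (\<pi> \<circ> transpose (\<sigma> s) (Suc m)))"
    unfolding jm_def
  proof (rule sum.cong)
    fix s assume "s \<in> {1..m}"
    then have "\<sigma> \<circ> \<pi> \<circ> \<sigma> \<circ> transpose s (Suc m) = \<sigma> \<circ> (\<pi> \<circ> transpose (\<sigma> s) (Suc m)) \<circ> \<sigma>"
      using i by (auto simp: fun_eq_iff \<sigma>_def transpose_def)
    then show "\<phi> (\<sigma> \<circ> \<pi> \<circ> \<sigma> \<circ> transpose s (Suc m)) = \<phi> (\<pi> \<circ> transpose (\<sigma> s) (Suc m))"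
      by (simp only: \<phi>)
  qed simp
  also have "\<dots> = jm m \<phi> \<pi>"
    unfolding jm_def \<sigma>_def using i
    by (intro sum.reindex_bij_betw[where h = "transpose i (Suc i)"]) auto
  finally show ?thesis .
qed

context
  fixes m :: nat and \<sigma> :: "nat \<Rightarrow> nat"
    and \<phi> :: "(nat \<Rightarrow> nat) \<Rightarrow> 'a::comm_monoid_add"
  defines "\<sigma> \<equiv> transpose (Suc m) (Suc (Suc m))"
  assumes \<phi>: "\<And>\<pi>. \<phi> (\<sigma> \<circ> \<pi> \<circ> \<sigma>) = \<phi> \<pi>"
begin

text \<open>Conjugation by \<sigma> exchanges (s m+1) with (s m+2) for s \<le> m and fixes \<sigma>,
  the one further summand of J_{m+2}.\<close>

lemma jm_sum_conj:
  "jm m \<phi> (\<sigma> \<circ> \<pi> \<circ> \<sigma>) + jm (Suc m) \<phi> (\<sigma> \<circ> \<pi> \<circ> \<sigma>) = jm m \<phi> \<pi> + jm (Suc m) \<phi> \<pi>"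
proof -
  let ?a = "\<lambda>\<rho>. \<Sum>s\<in>{1..m}. \<phi> (\<rho> \<circ> transpose s (Suc m))"
  let ?b = "\<lambda>\<rho>. \<Sum>s\<in>{1..m}. \<phi> (\<rho> \<circ> transpose s (Suc (Suc m)))"
  have *: "jm m \<phi> \<rho> + jm (Suc m) \<phi> \<rho> = ?a \<rho> + ?b \<rho> + \<phi> (\<rho> \<circ> \<sigma>)" for \<rho>
    by (simp add: jm_def \<sigma>_def add_ac)
  have "?a (\<sigma> \<circ> \<pi> \<circ> \<sigma>) = ?b \<pi>"
  proof (rule sum.cong)
    fix s assume "s \<in> {1..m}"
    then have "\<sigma> \<circ> \<pi> \<circ> \<sigma> \<circ> transpose s (Suc m) = \<sigma> \<circ> (\<pi> \<circ> transpose s (Suc (Suc m))) \<circ> \<sigma>"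
      by (auto simp: fun_eq_iff \<sigma>_def transpose_def)
    then show "\<phi> (\<sigma> \<circ> \<pi> \<circ> \<sigma> \<circ> transpose s (Suc m)) = \<phi> (\<pi> \<circ> transpose s (Suc (Suc m)))"
      by (simp only: \<phi>)
  qed simp
  moreover have "?b (\<sigma> \<circ> \<pi> \<circ> \<sigma>) = ?a \<pi>"
  proof (rule sum.cong)
    fix s assume "s \<in> {1..m}"
    then have "\<sigma> \<circ> \<pi> \<circ> \<sigma> \<circ> transpose s (Suc (Suc m)) = \<sigma> \<circ> (\<pi> \<circ> transpose s (Suc m)) \<circ> \<sigma>"
      by (auto simp: fun_eq_iff \<sigma>_def transpose_def)
    then show "\<phi> (\<sigma> \<circ> \<pi> \<circ> \<sigma> \<circ> transpose s (Suc (Suc m))) = \<phi> (\<pi> \<circ> transpose s (Suc m))"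
      by (simp only: \<phi>)
  qed simp
  moreover have "\<phi> (\<sigma> \<circ> \<pi> \<circ> \<sigma> \<circ> \<sigma>) = \<phi> (\<pi> \<circ> \<sigma>)"
    using \<phi>[of "\<pi> \<circ> \<sigma>"] by (simp only: comp_assoc)
  ultimately show ?thesis
    by (simp add: * add_ac)
qed

lemma jm_prod_conj: "jm m (jm (Suc m) \<phi>) (\<sigma> \<circ> \<pi> \<circ> \<sigma>) = jm m (jm (Suc m) \<phi>) \<pi>"
proof -
  let ?T = "\<lambda>s. transpose s (Suc m)" and ?U = "\<lambda>s. transpose s (Suc (Suc m))"
  have expand: "jm m (jm (Suc m) \<phi>) \<rho> =
      (\<Sum>s\<in>{1..m}. (\<Sum>t\<in>{1..m}. \<phi> (\<rho> \<circ> ?T s \<circ> ?U t)) + \<phi> (\<rho> \<circ> ?T s \<circ> \<sigma>))" for \<rho>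
    by (simp add: jm_def \<sigma>_def)
  have "jm m (jm (Suc m) \<phi>) (\<sigma> \<circ> \<pi> \<circ> \<sigma>) =
      (\<Sum>s\<in>{1..m}. (\<Sum>t\<in>{1..m}. \<phi> (\<pi> \<circ> ?U s \<circ> ?T t)) + \<phi> (\<pi> \<circ> ?U s \<circ> \<sigma>))"
    unfolding expand
  proof (intro sum.cong refl arg_cong2[of _ _ _ _ "(+)"])
    fix s t assume "s \<in> {1..m}" "t \<in> {1..m}"
    then have "\<sigma> \<circ> \<pi> \<circ> \<sigma> \<circ> ?T s \<circ> ?U t = \<sigma> \<circ> (\<pi> \<circ> ?U s \<circ> ?T t) \<circ> \<sigma>"
      by (auto simp: fun_eq_iff \<sigma>_def transpose_def)
    then show "\<phi> (\<sigma> \<circ> \<pi> \<circ> \<sigma> \<circ> ?T s \<circ> ?U t) = \<phi> (\<pi> \<circ> ?U s \<circ> ?T t)"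
      by (simp only: \<phi>)
  next
    fix s assume "s \<in> {1..m}"
    then have "\<sigma> \<circ> \<pi> \<circ> \<sigma> \<circ> ?T s \<circ> \<sigma> = \<sigma> \<circ> (\<pi> \<circ> ?U s \<circ> \<sigma>) \<circ> \<sigma>"
      by (auto simp: fun_eq_iff \<sigma>_def transpose_def)
    then show "\<phi> (\<sigma> \<circ> \<pi> \<circ> \<sigma> \<circ> ?T s \<circ> \<sigma>) = \<phi> (\<pi> \<circ> ?U s \<circ> \<sigma>)"
      by (simp only: \<phi>)
  qed
  also have "\<dots> = (\<Sum>s\<in>{1..m}. (\<Sum>t\<in>{1..m}. \<phi> (\<pi> \<circ> ?U t \<circ> ?T s)) + \<phi> (\<pi> \<circ> ?U s \<circ> \<sigma>))"
    unfolding sum.distrib by (subst sum.swap) (rule refl)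
  also have "\<dots> = (\<Sum>s\<in>{1..m}. (\<Sum>t\<in>{1..m}. \<phi> (\<pi> \<circ> ?T s \<circ> ?U t)) + \<phi> (\<pi> \<circ> ?T s \<circ> \<sigma>))"
  proof (rule sum.cong)
    fix s assume s: "s \<in> {1..m}"
    have "(\<Sum>t\<in>{1..m} - {s}. \<phi> (\<pi> \<circ> ?U t \<circ> ?T s)) = (\<Sum>t\<in>{1..m} - {s}. \<phi> (\<pi> \<circ> ?T s \<circ> ?U t))"
    proof (rule sum.cong)
      fix t assume "t \<in> {1..m} - {s}"
      then have "\<pi> \<circ> ?U t \<circ> ?T s = \<pi> \<circ> ?T s \<circ> ?U t"
        using s by (auto simp: fun_eq_iff transpose_def)
      then show "\<phi> (\<pi> \<circ> ?U t \<circ> ?T s) = \<phi> (\<pi> \<circ> ?T s \<circ> ?U t)"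
        by (simp only:)
    qed simp
    \<comment> \<open>For t = s the two transpositions do not commute, but the diagonal terms trade
      places with those that contain \<sigma>.\<close>
    moreover have "\<pi> \<circ> ?U s \<circ> ?T s = \<pi> \<circ> ?T s \<circ> \<sigma>" "\<pi> \<circ> ?U s \<circ> \<sigma> = \<pi> \<circ> ?T s \<circ> ?U s"
      using s by (auto simp: fun_eq_iff \<sigma>_def transpose_def)
    ultimately show "(\<Sum>t\<in>{1..m}. \<phi> (\<pi> \<circ> ?U t \<circ> ?T s)) + \<phi> (\<pi> \<circ> ?U s \<circ> \<sigma>) =
        (\<Sum>t\<in>{1..m}. \<phi> (\<pi> \<circ> ?T s \<circ> ?U t)) + \<phi> (\<pi> \<circ> ?T s \<circ> \<sigma>)"
      using s by (simp add: sum.remove[of _ s] add_ac)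
  qed simp
  finally show ?thesis
    unfolding expand .
qed

end

text \<open>
  Only the two Jucys--Murphy elements $J_i$, $J_{i+1}$ fail to commute with $\sigma = (i\;i{+}1)$,
  but their sum and product do, so the generating function of \<open>prim_count (i + 1)\<close>, which is
  $(1 - z J_i)^{-1} (1 - z J_{i+1})^{-1}$ times that of \<open>prim_count (i - 1)\<close>, is
  invariant under conjugation by $\sigma$.
\<close>

lemma prim_count_conj_top:
  fixes m :: nat
  defines "\<sigma> \<equiv> transpose (Suc m) (Suc (Suc m))"
  shows "prim_count (Suc (Suc m)) k (\<sigma> \<circ> \<pi> \<circ> \<sigma>) = prim_count (Suc (Suc m)) k \<pi>"
proof (induction k arbitrary: \<pi> rule: less_induct)
  case (less k)
  let ?c = "prim_count (Suc (Suc m))"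
  have low: "prim_count m k (\<sigma> \<circ> \<pi> \<circ> \<sigma>) = prim_count m k \<pi>" for k \<pi>
    unfolding \<sigma>_def by (rule prim_count_conj_disjoint) simp
  show ?case
  proof (cases k)
    case 0
    then show ?thesis
      by (simp only: prim_count_0 \<sigma>_def transpose_conj_id_iff)
  next
    case (Suc j)
    show ?thesis
    proof (cases j)
      case 0
      have "?c k \<rho> = prim_count m k \<rho> + (jm m (?c j) \<rho> + jm (Suc m) (?c j) \<rho>)" for \<rho>
      proof -
        have "prim_count (Suc m) j = ?c j"
          by (simp add: 0 prim_count_0 fun_eq_iff)
        then show ?thesis
          by (simp add: Suc prim_count_Suc_jm)
      qed
      moreover have "?c j (\<sigma> \<circ> \<rho> \<circ> \<sigma>) = ?c j \<rho>" for \<rho>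
        by (rule less.IH) (simp add: Suc)
      ultimately show ?thesis
        using jm_sum_conj[where m = m and \<phi> = "?c j" and \<pi> = \<pi>] low by (simp only: \<sigma>_def)
    next
      case (Suc l)
      note k = \<open>k = Suc j\<close> Suc
      \<comment> \<open>The coefficient of z^k in (1 - z J_{m+1}) (1 - z J_{m+2}) F_{m+2} = F_m. Two
        uses of the recursion eliminate \<open>prim_count (Suc m)\<close>, which in general is not
        invariant under \<sigma>; what remains involves only the sum and the product of the two
        elements.\<close>
      have "?c k \<rho> = prim_count m k \<rho> + (jm m (?c j) \<rho> + jm (Suc m) (?c j) \<rho>)
          - jm m (jm (Suc m) (?c l)) \<rho>" for \<rho>
      proof -
        have "prim_count (Suc m) j \<rho> = ?c j \<rho> - jm (Suc m) (?c l) \<rho>" for \<rho>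
          by (simp add: Suc prim_count_Suc_jm)
        then have "jm m (prim_count (Suc m) j) \<rho> = jm m (?c j) \<rho> - jm m (jm (Suc m) (?c l)) \<rho>"
          by (simp add: jm_def[of m] sum_subtractf)
        then show ?thesis
          by (simp add: k(1) prim_count_Suc_jm)
      qed
      moreover have "?c j (\<sigma> \<circ> \<rho> \<circ> \<sigma>) = ?c j \<rho>" "?c l (\<sigma> \<circ> \<rho> \<circ> \<sigma>) = ?c l \<rho>" for \<rho>
        by (rule less.IH, simp add: k)+
      ultimately show ?thesis
        using jm_sum_conj[where m = m and \<phi> = "?c j" and \<pi> = \<pi>] jm_prod_conj[where m = m and \<phi> = "?c l" and \<pi> = \<pi>] low
        by (simp only: \<sigma>_def)
    qed
  qed
qed

text \<open>Every J_n with n > i + 1 commutes with \<sigma>, so these are peeled off until i + 1 is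
  the largest index.\<close>

lemma prim_count_conj_adjacent:
  assumes "1 \<le> i"
  defines "\<sigma> \<equiv> transpose i (Suc i)"
  assumes "Suc i \<le> n"
  shows "prim_count n k (\<sigma> \<circ> \<pi> \<circ> \<sigma>) = prim_count n k \<pi>"
  using \<open>Suc i \<le> n\<close>
proof (induction n arbitrary: k \<pi>)
  case 0
  then show ?case by simp
next
  case (Suc m)
  note outer = Suc.IH
  show ?case
  proof (cases "i = m")
    case True
    then obtain j where "i = Suc j" "m = Suc j"
      using assms(1) by (cases i) auto
    then show ?thesis
      by (simp only: \<sigma>_def prim_count_conj_top)
  next
    case False
    then have "i < m"
      using Suc.prems by simp
    show ?thesis
    proof (induction k arbitrary: \<pi>)
      case 0
      show ?case
        by (simp only: prim_count_0 \<sigma>_def transpose_conj_id_iff)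
    next
      case (Suc k)
      then have "jm m (prim_count (Suc m) k) (\<sigma> \<circ> \<pi> \<circ> \<sigma>) = jm m (prim_count (Suc m) k) \<pi>"
        unfolding \<sigma>_def using assms(1) \<open>i < m\<close> by (intro jm_conj_lower)
      moreover have "prim_count m (Suc k) (\<sigma> \<circ> \<pi> \<circ> \<sigma>) = prim_count m (Suc k) \<pi>"
        using outer \<open>i < m\<close> by (simp only: Suc_le_eq)
      ultimately show ?case
        by (simp only: prim_count_Suc_jm)
    qed
  qed
qed

lemma prim_count_conj_transpose:
  assumes "1 \<le> a" "a < b" "b \<le> n"
  shows "prim_count n k (transpose a b \<circ> \<pi> \<circ> transpose a b) = prim_count n k \<pi>"
  using assms(2,3)
proof (induction b arbitrary: \<pi> rule: less_induct)
  case (less b)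
  show ?case
  proof (cases "b = Suc a")
    case True
    then show ?thesis
      using prim_count_conj_adjacent[of a n] assms(1) less.prems by (simp only:)
  next
    case False
    then obtain c where c: "b = Suc c" "a < c"
      using less.prems by (metis Suc_lessI not_less_eq less_imp_Suc_add less_add_Suc1)
    let ?\<sigma> = "transpose c (Suc c)"
    have "transpose a b = ?\<sigma> \<circ> transpose a c \<circ> ?\<sigma>"
      using c by (auto simp: fun_eq_iff transpose_def)
    then have "transpose a b \<circ> \<pi> \<circ> transpose a b =
        ?\<sigma> \<circ> (transpose a c \<circ> (?\<sigma> \<circ> \<pi> \<circ> ?\<sigma>) \<circ> transpose a c) \<circ> ?\<sigma>"
      by (simp only: comp_assoc)
    moreover have "1 \<le> c" "Suc c \<le> n" "c < b" "c \<le> n"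
      using c assms(1) less.prems by auto
    ultimately show ?thesis
      using less.IH[of c] prim_count_conj_adjacent[of c n] c(2) by (simp only:)
  qed
qed

lemma prim_count_conj:
  assumes "p permutes {1..n}"
  shows "prim_count n k (p \<circ> \<pi> \<circ> inv p) = prim_count n k \<pi>"
  using assms finite_atLeastAtMost
proof (induction p arbitrary: \<pi> rule: permutes_induct)
  case id
  then show ?case by simp
next
  case (swap a b p)
  have "inv (transpose a b \<circ> p) = inv p \<circ> transpose a b"
    using swap.hyps by (simp add: o_inv_distrib permutes_bij)
  then have "transpose a b \<circ> p \<circ> \<pi> \<circ> inv (transpose a b \<circ> p) =
      transpose a b \<circ> (p \<circ> \<pi> \<circ> inv p) \<circ> transpose a b"
    by (simp add: comp_assoc)
  moreover have "prim_count n k (transpose a b \<circ> \<rho> \<circ> transpose a b) = prim_count n k \<rho>" for \<rho>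
  proof (cases "a < b")
    case True
    then show ?thesis
      using swap.hyps by (intro prim_count_conj_transpose) auto
  next
    case False
    then have "b < a" "1 \<le> b" "a \<le> n"
      using swap.hyps by auto
    then show ?thesis
      using prim_count_conj_transpose[of b a n] by (simp only: transpose_commute[of a b])
  qed
  ultimately show ?case
    using swap.IH by (simp only:)
qed

section \<open>Cutting and joining cycles\<close>

text \<open>Used to list the orbits of a modified permutation explicitly, from a walk that follows
  it back to its start.\<close>

lemma orbit_eq_image_closed_walk:
  assumes "\<And>j. j < k \<Longrightarrow> g (h j) = h (Suc j)" and "h k = h 0" and "0 < k"
  shows "orbit g (h 0) = h ` {0..<k}"
proof -
  have walk: "(g ^^ j) (h 0) = h j" if "j \<le> k" for j
    using that by (induction j) (simp_all add: assms(1))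
  then have "(g ^^ k) (h 0) = h 0"
    using assms(2) by simp
  then have "orbit g (h 0) = {(g ^^ j) (h 0) | j. j < k}"
    using assms(3) by (rule orbit_altdef_bounded)
  also have "\<dots> = (\<lambda>j. (g ^^ j) (h 0)) ` {0..<k}"
    by auto
  also have "\<dots> = h ` {0..<k}"
    by (rule image_cong) (simp_all add: walk)
  finally show ?thesis .
qed

lemma orbit_eq_funpow_image:
  fixes \<pi> :: "'a \<Rightarrow> 'a" and a :: 'a
  assumes "permutation \<pi>"
  defines "l \<equiv> card (orbit \<pi> a)"
  shows "0 < l" and "(\<pi> ^^ l) a = a" and "inj_on (\<lambda>j. (\<pi> ^^ j) a) {0..<l}"
    and "orbit \<pi> a = (\<lambda>j. (\<pi> ^^ j) a) ` {0..<l}"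
proof -
  have self: "a \<in> orbit \<pi> a"
    using assms(1) by (rule permutation_self_in_orbit)
  have inj: "inj_on (\<lambda>j. (\<pi> ^^ j) a) {0..<funpow_dist1 \<pi> a a}"
    using self by (rule inj_on_funpow_dist1)
  have img: "orbit \<pi> a = (\<lambda>j. (\<pi> ^^ j) a) ` {0..<funpow_dist1 \<pi> a a}"
    using self by (rule orbit_conv_funpow_dist1)
  have l: "l = funpow_dist1 \<pi> a a"
    unfolding l_def by (subst img) (simp add: card_image[OF inj])
  show "0 < l" "inj_on (\<lambda>j. (\<pi> ^^ j) a) {0..<l}" "orbit \<pi> a = (\<lambda>j. (\<pi> ^^ j) a) ` {0..<l}"
    using inj img by (simp_all add: l)
  show "(\<pi> ^^ l) a = a"
    unfolding l using self by (rule funpow_dist1_prop)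
qed

lemma orbits_eq_or_disjoint:
  assumes "permutation \<pi>"
  shows "orbit \<pi> a = orbit \<pi> b \<or> orbit \<pi> a \<inter> orbit \<pi> b = {}"
proof (cases "orbit \<pi> a \<inter> orbit \<pi> b = {}")
  case False
  then obtain c where "c \<in> orbit \<pi> a" "c \<in> orbit \<pi> b"
    by blast
  then show ?thesis
    using orbit_cyclic_eq3[OF cyclic_on_orbit'[OF assms]] by metis
qed simp

text \<open>Composing with (b a) on the right swaps the successors of a and b: b now steps to \<pi>
  a and returns to itself after i steps, while a steps to \<pi> b and returns after the remaining l
  - i.\<close>

lemma orbit_comp_transpose_cut:
  fixes \<pi> :: "'a \<Rightarrow> 'a" and a b :: 'a
  assumes \<pi>: "permutation \<pi>"
    and i: "0 < i" "i < card (orbit \<pi> a)" and b: "b = (\<pi> ^^ i) a"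
  defines "\<rho> \<equiv> \<pi> \<circ> transpose b a"
  shows "card (orbit \<rho> b) = i" and "card (orbit \<rho> a) = card (orbit \<pi> a) - i"
    and "orbit \<rho> a \<inter> orbit \<rho> b = {}" and "orbit \<rho> a \<union> orbit \<rho> b = orbit \<pi> a"
proof -
  let ?l = "card (orbit \<pi> a)" and ?p = "\<lambda>j. (\<pi> ^^ j) a"
  note l = orbit_eq_funpow_image[OF \<pi>, of a]
  have neq: "?p j \<noteq> ?p k" if "j < ?l" "k < ?l" "j \<noteq> k" for j k
    using l(3) that by (auto simp: inj_on_def)
  have step: "\<rho> (?p j) = ?p (Suc j)" if "0 < j" "j \<noteq> i" "j < ?l" for j
  proof -
    have "?p j \<noteq> b" "?p j \<noteq> a"
      using neq[of j i] neq[of j 0] that i by (auto simp: b)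
    then show ?thesis
      by (simp add: \<rho>_def)
  qed
  \<comment> \<open>The old walk from a with its start replaced by b; it closes because
    \<open>?p i\<close> is b.\<close>
  let ?h = "\<lambda>j. if j = 0 then b else ?p j"
  have "orbit \<rho> (?h 0) = ?h ` {0..<i}"
  proof (rule orbit_eq_image_closed_walk)
    show "\<rho> (?h j) = ?h (Suc j)" if "j < i" for j
      using step[of j] that i by (auto simp: \<rho>_def)
  qed (use i b in auto)
  also have "?h ` {0..<i} = ?p ` {1..i}"
  proof -
    have "{0..<i} = insert 0 {1..<i}" "{1..i} = insert i {1..<i}"
      using i by auto
    moreover have "?h ` {1..<i} = ?p ` {1..<i}"
      by (rule image_cong) auto
    ultimately show ?thesis
      by (simp only: image_insert) (simp add: b)
  qed
  finally have orb_b: "orbit \<rho> b = ?p ` {1..i}"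
    by simp
  \<comment> \<open>From a the walk jumps over the first i points and closes at
    \<open>?p ?l\<close>, which is a.\<close>
  let ?h = "\<lambda>j. if j = 0 then a else ?p (i + j)"
  have "orbit \<rho> (?h 0) = ?h ` {0..<?l - i}"
  proof (rule orbit_eq_image_closed_walk)
    show "\<rho> (?h j) = ?h (Suc j)" if "j < ?l - i" for j
      using step[of "i + j"] that i by (auto simp: \<rho>_def b)
  qed (use i l(2) in auto)
  also have "?h ` {0..<?l - i} = ?p ` insert 0 {i + 1..<?l}"
  proof -
    have "(+) i ` {1..<?l - i} = {i + 1..<?l}"
      using i unfolding image_add_atLeastLessThan by simp
    moreover have "?h ` {1..<?l - i} = ?p ` (+) i ` {1..<?l - i}"
      unfolding image_image by (rule image_cong) auto
    moreover have "{0..<?l - i} = insert 0 {1..<?l - i}"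
      using i by auto
    ultimately show ?thesis
      by (simp only: image_insert) simp
  qed
  finally have orb_a: "orbit \<rho> a = ?p ` insert 0 {i + 1..<?l}"
    by simp
  have sub: "{1..i} \<subseteq> {0..<?l}" "insert 0 {i + 1..<?l} \<subseteq> {0..<?l}"
    using i by auto
  show "card (orbit \<rho> b) = i" "card (orbit \<rho> a) = ?l - i"
    unfolding orb_a orb_b card_image[OF inj_on_subset[OF l(3) sub(1)]]
      card_image[OF inj_on_subset[OF l(3) sub(2)]]
    using i by simp_all
  have "orbit \<rho> a \<inter> orbit \<rho> b = ?p ` (insert 0 {i + 1..<?l} \<inter> {1..i})"
    unfolding orb_a orb_b using inj_on_image_Int[OF l(3) sub(2) sub(1)] by simp
  moreover have "insert 0 {i + 1..<?l} \<inter> {1..i} = {}"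
    by auto
  ultimately show "orbit \<rho> a \<inter> orbit \<rho> b = {}"
    by (simp only: image_empty)
  have "insert 0 {i + 1..<?l} \<union> {1..i} = {0..<?l}"
    using i by auto
  then show "orbit \<rho> a \<union> orbit \<rho> b = orbit \<pi> a"
    unfolding orb_a orb_b image_Un[symmetric] by (simp only: l(4)[symmetric])
qed

text \<open>The new permutation sends a to \<pi> b and then follows the cycle of b, which avoids a,
  until it reaches b.\<close>

lemma in_orbit_comp_transpose:
  assumes "permutation \<pi>" and "b \<notin> orbit \<pi> a"
  shows "b \<in> orbit (\<pi> \<circ> transpose b a) a"
proof -
  let ?\<rho> = "\<pi> \<circ> transpose b a" and ?m = "card (orbit \<pi> b)"
  note m = orbit_eq_funpow_image[OF assms(1), of b]
  have a: "a \<notin> orbit \<pi> b"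
    using assms orbit_swap permutation_self_in_orbit by metis
  have walk: "(?\<rho> ^^ j) a = (\<pi> ^^ j) b" if "0 < j" "j \<le> ?m" for j
    using that
  proof (induction j)
    case (Suc j)
    show ?case
    proof (cases "j = 0")
      case False
      then have "(\<pi> ^^ j) b \<noteq> (\<pi> ^^ 0) b"
        using Suc.prems inj_on_eq_iff[OF m(3), of j 0] by auto
      moreover have "(\<pi> ^^ j) b \<in> orbit \<pi> b"
        using assms(1) permutation_self_in_orbit funpow_in_orbit by metis
      ultimately have "(\<pi> ^^ j) b \<in> orbit \<pi> b" "(\<pi> ^^ j) b \<noteq> b"
        by simp_all
      then have "transpose b a ((\<pi> ^^ j) b) = (\<pi> ^^ j) b"
        using a by (intro transpose_apply_other) auto
      then show ?thesis
        using Suc False by simp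
    qed simp
  qed simp
  then have "(?\<rho> ^^ ?m) a = b"
    using m(1,2) by simp
  then show ?thesis
    using m(1) by (subst orbit_altdef, intro CollectI exI[of _ ?m]) simp
qed

text \<open>
  The class function \<open>cycle_poly \<pi> A\<close> is $\det(1 - x\pi)$ on the permutation representation, i.e.
  $(1 - x) \sum_r (-x)^r \chi^{(n-r, 1^r)}(\pi)$. The quotient by $1 - x$, which generates the hook
  characters, is \<open>hook_poly\<close>; that it does not depend on the choice of \<open>a\<close> is
  \<open>hook_poly_mult\<close>.
\<close>

definition cycle_poly :: "('a \<Rightarrow> 'a) \<Rightarrow> 'a set \<Rightarrow> rat poly"
  where "cycle_poly \<pi> A = (\<Prod>D\<in>orbit \<pi> ` A. 1 - monom 1 (card D))"

text \<open>Sets apart the cycle of \<open>a\<close>, since every transposition (b a) with b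
  \<noteq> a either cuts it or joins another cycle to it.\<close>

definition rest_poly :: "('a \<Rightarrow> 'a) \<Rightarrow> 'a set \<Rightarrow> 'a \<Rightarrow> rat poly"
  where "rest_poly \<pi> A a = cycle_poly \<pi> (A - orbit \<pi> a)"

definition hook_poly :: "('a \<Rightarrow> 'a) \<Rightarrow> 'a set \<Rightarrow> 'a \<Rightarrow> rat poly"
  where "hook_poly \<pi> A a = rest_poly \<pi> A a * (\<Sum>i<card (orbit \<pi> a). monom 1 i)"

lemma geometric_poly: "(1 - monom 1 1) * (\<Sum>i<l. monom 1 i) = (1 - monom 1 l :: rat poly)"
  using one_diff_power_eq[of "monom 1 1 :: rat poly" l]
  by (simp add: monom_power)

section \<open>Sums of the cycle and hook polynomials over the transpositions moving
  \<open>a\<close>\<close>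

locale pointed_permutation =
  fixes A :: "'a set" and \<pi> :: "'a \<Rightarrow> 'a" and a :: 'a
  assumes finite: "finite A" and permutes: "\<pi> permutes A" and a: "a \<in> A"
begin

abbreviation "C \<equiv> orbit \<pi> a"
abbreviation "l \<equiv> card C"
abbreviation "P \<equiv> rest_poly \<pi> A a"
abbreviation "Ds \<equiv> orbit \<pi> ` (A - C)"

lemma permutation: "permutation \<pi>"
  using finite permutes permutation_permutes by blast

lemma self_in_orbit: "b \<in> orbit \<pi> b"
  using permutation by (rule permutation_self_in_orbit)

lemma orbit_eq_iff: "orbit \<pi> b = orbit \<pi> c \<longleftrightarrow> b \<in> orbit \<pi> c"
  using orbits_eq_or_disjoint[OF permutation, of b c] self_in_orbit by blast

lemma orbit_subset_A: "b \<in> A \<Longrightarrow> orbit \<pi> b \<subseteq> A"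
  using permutes by (rule permutes_orbit_subset)

lemma l_le: "l \<le> card A"
  using finite a by (intro card_mono orbit_subset_A)

lemma l_pos: "0 < l"
  using orbit_eq_funpow_image(1)[OF permutation] .

lemma finite_Ds: "finite Ds"
  using finite by simp

lemma cycle_poly_eq: "cycle_poly \<pi> A = P * (1 - monom 1 l)"
proof -
  have "orbit \<pi> ` A = insert C Ds"
    using a orbit_eq_iff by auto
  moreover have "C \<notin> Ds"
    using self_in_orbit by (auto simp: orbit_eq_iff)
  ultimately show ?thesis
    using finite_Ds by (simp add: cycle_poly_def rest_poly_def mult.commute)
qed

lemma hook_poly_mult: "(1 - monom 1 1) * hook_poly \<pi> A a = cycle_poly \<pi> A"
proof -
  have "(1 - monom 1 1) * hook_poly \<pi> A a = P * ((1 - monom 1 1) * (\<Sum>i<l. monom 1 i))"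
    by (simp only: hook_poly_def ac_simps)
  then show ?thesis
    by (simp only: geometric_poly cycle_poly_eq)
qed

lemma pointed_permutation_comp:
  assumes "b \<in> A"
  shows "pointed_permutation A (\<pi> \<circ> transpose b a) a"
  using finite permutes a assms by unfold_locales (simp_all add: permutes_compose permutes_swap_id)

lemma orbit_comp_transpose_outside:
  assumes "\<And>x. x \<in> B \<Longrightarrow> \<pi> x \<in> B" "a \<notin> B" "b \<notin> B" "c \<in> B"
  shows "orbit (\<pi> \<circ> transpose b a) c = orbit \<pi> c"
proof (rule orbit_cong0[symmetric, OF \<open>c \<in> B\<close>])
  show "\<pi> y = (\<pi> \<circ> transpose b a) y" if "y \<in> B" for y
  proof -
    have "y \<noteq> a" "y \<noteq> b"
      using that assms by auto
    then show ?thesis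
      by simp
  qed
qed (use assms(1) in auto)

lemma image_outside_orbits: "x \<in> A - orbit \<pi> b - orbit \<pi> c \<Longrightarrow> \<pi> x \<in> A - orbit \<pi> b - orbit \<pi> c"
  using permutes_in_image[OF permutes, of x] permutation_orbit_step[OF permutation, of x]
    orbit_eq_iff by (metis DiffD1 DiffD2 DiffI)

lemma rest_poly_cut:
  assumes "0 < i" "i < l"
  defines "\<rho> \<equiv> \<pi> \<circ> transpose ((\<pi> ^^ i) a) a"
  shows "card (orbit \<rho> a) = l - i" and "rest_poly \<rho> A a = P * (1 - monom 1 i)"
proof -
  let ?b = "(\<pi> ^^ i) a"
  note cut = orbit_comp_transpose_cut[OF permutation assms(1,2) refl, folded \<rho>_def]
  have C: "?b \<in> C" "a \<in> C" "C \<subseteq> A"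
    using a orbit_subset_A by (auto simp: self_in_orbit funpow_in_orbit)
  interpret r: pointed_permutation A \<rho> a
    unfolding \<rho>_def using C by (intro pointed_permutation_comp) auto
  show "card (orbit \<rho> a) = l - i"
    by (fact cut(2))
  have "A - orbit \<rho> a = (A - C) \<union> orbit \<rho> ?b"
    using cut(3,4) C(3) by blast
  then have "orbit \<rho> ` (A - orbit \<rho> a) = orbit \<rho> ` (A - C) \<union> orbit \<rho> ` orbit \<rho> ?b"
    by (simp add: image_Un)
  also have "orbit \<rho> ` orbit \<rho> ?b = {orbit \<rho> ?b}"
    using r.orbit_eq_iff r.self_in_orbit by auto
  also have "orbit \<rho> ` (A - C) = Ds"
  proof (rule image_cong)
    show "orbit \<rho> c = orbit \<pi> c" if "c \<in> A - C" for c
      unfolding \<rho>_def using that C image_outside_orbits[of _ a a]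
      by (intro orbit_comp_transpose_outside[of "A - C"]) auto
  qed simp
  finally have "orbit \<rho> ` (A - orbit \<rho> a) = insert (orbit \<rho> ?b) Ds"
    by simp
  \<comment> \<open>The product runs over a set of orbits, so the piece cut off yields a factor of
    its own only if it is a new member.\<close>
  moreover have "orbit \<rho> ?b \<notin> Ds"
  proof
    assume "orbit \<rho> ?b \<in> Ds"
    then obtain c where "c \<in> A - C" "orbit \<rho> ?b = orbit \<pi> c"
      by auto
    then show False
      using cut(4) self_in_orbit[of c] by blast
  qed
  ultimately show "rest_poly \<rho> A a = P * (1 - monom 1 i)"
    using finite_Ds cut(1) by (simp add: cycle_poly_def rest_poly_def mult.commute)
qed

text \<open>Composing with (b a) once more cuts the joined cycle back into the two old ones, so the
  cut lemma applied to \<rho> yields the lengths.\<close>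

lemma rest_poly_join:
  assumes b: "b \<in> A - C"
  defines "\<rho> \<equiv> \<pi> \<circ> transpose b a"
  shows "card (orbit \<rho> a) = l + card (orbit \<pi> b)"
    and "rest_poly \<rho> A a = (\<Prod>D\<in>Ds - {orbit \<pi> b}. 1 - monom 1 (card D))"
proof -
  interpret r: pointed_permutation A \<rho> a
    unfolding \<rho>_def using b by (intro pointed_permutation_comp) auto
  have \<pi>: "\<pi> = \<rho> \<circ> transpose b a"
    by (simp add: \<rho>_def comp_assoc)
  have "b \<in> orbit \<rho> a"
    unfolding \<rho>_def using b permutation by (intro in_orbit_comp_transpose) auto
  then have "b \<in> (\<lambda>j. (\<rho> ^^ j) a) ` {0..<card (orbit \<rho> a)}"
    by (simp only: orbit_eq_funpow_image(4)[OF r.permutation, symmetric])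
  then obtain i where i: "i < card (orbit \<rho> a)" "b = (\<rho> ^^ i) a"
    by auto
  moreover have "0 < i"
    using b i(2) self_in_orbit[of a] by (cases i) auto
  ultimately have cut: "card (orbit \<pi> b) = i" "l = card (orbit \<rho> a) - i"
      "C \<inter> orbit \<pi> b = {}" "C \<union> orbit \<pi> b = orbit \<rho> a"
    using orbit_comp_transpose_cut[OF r.permutation, of i a b] unfolding \<pi>[symmetric] by auto
  show "card (orbit \<rho> a) = l + card (orbit \<pi> b)"
    using cut i(1) by simp
  have "orbit \<rho> ` (A - orbit \<rho> a) = orbit \<pi> ` (A - orbit \<rho> a)"
  proof (rule image_cong)
    show "orbit \<rho> c = orbit \<pi> c" if "c \<in> A - orbit \<rho> a" for c
      unfolding \<rho>_def using that self_in_orbit image_outside_orbits[of _ a b]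
      by (intro orbit_comp_transpose_outside[of "A - C - orbit \<pi> b"]) (auto simp: cut(4)[symmetric])
  qed simp
  also have "\<dots> = Ds - {orbit \<pi> b}"
    using orbit_eq_iff by (auto simp: cut(4)[symmetric])
  finally show "rest_poly \<rho> A a = (\<Prod>D\<in>Ds - {orbit \<pi> b}. 1 - monom 1 (card D))"
    by (simp add: cycle_poly_def rest_poly_def)
qed

lemma sum_over_orbits:
  fixes h :: "'a set \<Rightarrow> rat poly"
  shows "(\<Sum>b\<in>A - C. h (orbit \<pi> b)) = (\<Sum>D\<in>Ds. of_nat (card D) * h D)"
proof -
  have "(\<Sum>b\<in>A - C. h (orbit \<pi> b)) =
      (\<Sum>D\<in>Ds. \<Sum>b\<in>{b \<in> A - C. orbit \<pi> b = D}. h (orbit \<pi> b))"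
    using finite by (intro sum.image_gen) simp
  also have "\<dots> = (\<Sum>D\<in>Ds. of_nat (card D) * h D)"
  proof (rule sum.cong)
    fix D assume "D \<in> Ds"
    then obtain c where c: "c \<in> A" "c \<notin> C" "D = orbit \<pi> c"
      by auto
    have "b \<in> A - C" if "b \<in> D" for b
    proof
      show "b \<in> A"
        using that c orbit_subset_A[of c] by auto
      show "b \<notin> C"
      proof
        assume "b \<in> C"
        then have "orbit \<pi> c = C"
          using that c(3) by (metis orbit_eq_iff)
        then show False
          using c(2) self_in_orbit[of c] by simp
      qed
    qed
    then have D: "{b \<in> A - C. orbit \<pi> b = D} = D"
      unfolding c(3) orbit_eq_iff by blast
    have "(\<Sum>b\<in>{b \<in> A - C. orbit \<pi> b = D}. h (orbit \<pi> b)) =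
        (\<Sum>b\<in>{b \<in> A - C. orbit \<pi> b = D}. h D)"
      by (rule sum.cong) simp_all
    then show "(\<Sum>b\<in>{b \<in> A - C. orbit \<pi> b = D}. h (orbit \<pi> b)) = of_nat (card D) * h D"
      by (simp only: D sum_constant)
  qed simp
  finally show ?thesis .
qed

abbreviation "Q \<equiv> \<lambda>D. \<Prod>D'\<in>Ds - {D}. 1 - monom 1 (card D') :: rat poly"

lemma rest_poly_eq_Q: "D \<in> Ds \<Longrightarrow> P = Q D * (1 - monom 1 (card D))"
  using finite_Ds by (simp add: rest_poly_def cycle_poly_def prod.remove mult.commute)

text \<open>Product rule with x d/dx (1 - x^k) = -k x^k. Through it the orbit sizes that weight the
  joins become a derivative.\<close>

lemma x_pderiv_rest:
  "monom 1 1 * pderiv P = - (\<Sum>D\<in>Ds. of_nat (card D) * (Q D * monom 1 (card D)))"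
proof -
  have "monom 1 1 * pderiv (1 - monom 1 k) = - (of_nat k * monom 1 k :: rat poly)" for k
    by (cases k) (simp_all add: pderiv_diff pderiv_monom mult_monom of_nat_monom)
  then have "monom 1 1 * (Q D * pderiv (1 - monom 1 (card D))) =
      - (of_nat (card D) * (Q D * monom 1 (card D)))" for D
    by (metis (no_types, lifting) mult.left_commute mult_minus_right)
  then show ?thesis
    unfolding rest_poly_def cycle_poly_def pderiv_prod sum_distrib_left
    by (simp add: sum_negf)
qed

lemma sum_card_Ds: "(\<Sum>D\<in>Ds. of_nat (card D) :: rat poly) = of_nat (card A) - of_nat l"
proof -
  have "(\<Sum>D\<in>Ds. of_nat (card D) :: rat poly) = of_nat (card (A - C))"
    using sum_over_orbits[of "\<lambda>_. 1"] by simp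
  also have "card (A - C) = card A - l"
    using finite_subset[OF orbit_subset_A[OF a] finite] orbit_subset_A[OF a]
    by (rule card_Diff_subset)
  finally show ?thesis
    using l_le by (simp add: of_nat_diff)
qed

text \<open>From P = Q D (1 - x^|D|) one has Q D = P + Q D x^|D|; the first terms add up to a
  multiple of P, the second ones to -x P'.\<close>

lemma sum_Q: "(\<Sum>D\<in>Ds. of_nat (card D) * Q D) =
    (of_nat (card A) - of_nat l) * P - monom 1 1 * pderiv P"
proof -
  have "(\<Sum>D\<in>Ds. of_nat (card D) * Q D) =
      (\<Sum>D\<in>Ds. of_nat (card D) * P + of_nat (card D) * (Q D * monom 1 (card D)))"
    by (intro sum.cong) (simp_all add: rest_poly_eq_Q algebra_simps)
  also have "\<dots> = (of_nat (card A) - of_nat l) * P - monom 1 1 * pderiv P"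
    by (simp only: sum.distrib sum_distrib_right[symmetric] sum_card_Ds x_pderiv_rest)
  finally show ?thesis .
qed

lemma sum_over_transpositions:
  fixes h :: "'a \<Rightarrow> rat poly"
  shows "(\<Sum>b\<in>A - {a}. h b) = (\<Sum>i\<in>{1..<l}. h ((\<pi> ^^ i) a)) + (\<Sum>b\<in>A - C. h b)"
proof -
  have C: "C \<subseteq> A" "a \<in> C"
    using a orbit_subset_A self_in_orbit by auto
  have "(A - {a}) - (C - {a}) = A - C"
    using C by auto
  then have "(\<Sum>b\<in>A - {a}. h b) = (\<Sum>b\<in>C - {a}. h b) + (\<Sum>b\<in>A - C. h b)"
    using sum.subset_diff[of "C - {a}" "A - {a}" h] finite C(1) by (simp add: Diff_mono add.commute)
  moreover have "C - {a} = (\<lambda>i. (\<pi> ^^ i) a) ` {1..<l}" and "inj_on (\<lambda>i. (\<pi> ^^ i) a) {1..<l}"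
  proof -
    note c = orbit_eq_funpow_image[OF permutation, of a]
    show "inj_on (\<lambda>i. (\<pi> ^^ i) a) {1..<l}"
      by (rule inj_on_subset[OF c(3)]) auto
    have "{1..<l} = {0..<l} - {0}" by auto
    then have "(\<lambda>i. (\<pi> ^^ i) a) ` {1..<l} = (\<lambda>i. (\<pi> ^^ i) a) ` {0..<l} - (\<lambda>i. (\<pi> ^^ i) a) ` {0}"
      using c(1) by (simp only:) (intro inj_on_image_set_diff[OF c(3)], auto)
    then show "C - {a} = (\<lambda>i. (\<pi> ^^ i) a) ` {1..<l}"
      using c(4) by simp
  qed
  ultimately show ?thesis
    by (simp add: sum.reindex)
qed

text \<open>The cuts contribute P (1 - x^i) for 0 < i < l, the joins are \<open>sum_Q\<close>. The
  multiples of P by l cancel between the two, and P (1 + x + ... + x^(l-1)) is the hook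
  polynomial.\<close>

lemma rest_poly_sum:
  "(\<Sum>b\<in>A - {a}. rest_poly (\<pi> \<circ> transpose b a) A a) =
     of_nat (card A) * P - hook_poly \<pi> A a - monom 1 1 * pderiv P"
proof -
  define G :: "rat poly" where "G = (\<Sum>i<l. monom 1 i)"
  have G: "(\<Sum>i\<in>{1..<l}. monom 1 i) = G - 1"
    using l_pos by (simp add: G_def lessThan_atLeast0 sum.atLeast_Suc_lessThan)
  have "(\<Sum>i\<in>{1..<l}. rest_poly (\<pi> \<circ> transpose ((\<pi> ^^ i) a) a) A a) =
      (\<Sum>i\<in>{1..<l}. P - P * monom 1 i)"
    by (intro sum.cong) (simp_all add: rest_poly_cut algebra_simps)
  also have "\<dots> = (of_nat l - 1) * P - P * (G - 1)"
    using l_pos by (simp add: sum_subtractf sum_distrib_left[symmetric] G[unfolded One_nat_def] of_nat_diff)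
  finally have cut: "(\<Sum>i\<in>{1..<l}. rest_poly (\<pi> \<circ> transpose ((\<pi> ^^ i) a) a) A a) =
      (of_nat l - 1) * P - P * (G - 1)" .
  have "(\<Sum>b\<in>A - C. rest_poly (\<pi> \<circ> transpose b a) A a) = (\<Sum>b\<in>A - C. Q (orbit \<pi> b))"
    by (intro sum.cong rest_poly_join refl)
  also have "\<dots> = (of_nat (card A) - of_nat l) * P - monom 1 1 * pderiv P"
    by (simp only: sum_over_orbits[of Q] sum_Q)
  finally show ?thesis
    unfolding sum_over_transpositions cut hook_poly_def G_def[symmetric]
    by (simp add: algebra_simps)
qed

text \<open>A cut at i gives P (1 - x^i) (1 - x^(l-i)), and joining D gives Q D (1 -
  x^(l+|D|)).\<close>

lemma cycle_poly_sum:
  "(\<Sum>b\<in>A - {a}. cycle_poly (\<pi> \<circ> transpose b a) A) =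
     of_nat (card A) * P + cycle_poly \<pi> A - 2 * hook_poly \<pi> A a
       - monom 1 1 * pderiv (cycle_poly \<pi> A)"
proof -
  define G :: "rat poly" where "G = (\<Sum>i<l. monom 1 i)"
  have G: "(\<Sum>i\<in>{1..<l}. monom 1 i) = G - 1"
    using l_pos by (simp add: G_def lessThan_atLeast0 sum.atLeast_Suc_lessThan)
  have G': "(\<Sum>i\<in>{1..<l}. monom 1 (l - i)) = G - 1"
    unfolding G[symmetric] by (rule sum.reindex_bij_witness[of _ "\<lambda>i. l - i" "\<lambda>i. l - i"]) auto
  have cyc: "cycle_poly (\<pi> \<circ> transpose b a) A = rest_poly (\<pi> \<circ> transpose b a) A a *
      (1 - monom 1 (card (orbit (\<pi> \<circ> transpose b a) a)))" if "b \<in> A" for b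
    using that by (intro pointed_permutation.cycle_poly_eq pointed_permutation_comp)
  have "(\<Sum>i\<in>{1..<l}. cycle_poly (\<pi> \<circ> transpose ((\<pi> ^^ i) a) a) A) =
      (\<Sum>i\<in>{1..<l}. P * (1 + monom 1 l) - P * monom 1 i - P * monom 1 (l - i))"
  proof (rule sum.cong)
    fix i assume i: "i \<in> {1..<l}"
    have "(\<pi> ^^ i) a \<in> A"
      using a orbit_subset_A funpow_in_orbit self_in_orbit by (meson subsetD)
    moreover have "monom 1 i * monom 1 (l - i) = (monom 1 l :: rat poly)"
      using i by (simp add: mult_monom)
    ultimately show "cycle_poly (\<pi> \<circ> transpose ((\<pi> ^^ i) a) a) A =
        P * (1 + monom 1 l) - P * monom 1 i - P * monom 1 (l - i)"
      using i by (simp add: cyc rest_poly_cut) (simp add: algebra_simps)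
  qed simp
  also have "\<dots> = (of_nat l - 1) * (P * (1 + monom 1 l)) - 2 * (P * (G - 1))"
    using l_pos
    by (simp add: sum_subtractf sum_distrib_left[symmetric] G[unfolded One_nat_def]
        G'[unfolded One_nat_def] of_nat_diff)
  finally have cut: "(\<Sum>i\<in>{1..<l}. cycle_poly (\<pi> \<circ> transpose ((\<pi> ^^ i) a) a) A) =
      (of_nat l - 1) * (P * (1 + monom 1 l)) - 2 * (P * (G - 1))" .
  have "(\<Sum>b\<in>A - C. cycle_poly (\<pi> \<circ> transpose b a) A) =
      (\<Sum>b\<in>A - C. Q (orbit \<pi> b) * (1 - monom 1 l * monom 1 (card (orbit \<pi> b))))"
    by (intro sum.cong) (simp_all add: cyc rest_poly_join mult_monom)
  also have "\<dots> = (\<Sum>D\<in>Ds. of_nat (card D) * (Q D * (1 - monom 1 l * monom 1 (card D))))"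
    by (rule sum_over_orbits)
  also have "\<dots> = (\<Sum>D\<in>Ds. of_nat (card D) * Q D
      - monom 1 l * (of_nat (card D) * (Q D * monom 1 (card D))))"
    by (simp add: algebra_simps)
  also have "\<dots> = (of_nat (card A) - of_nat l) * P - (1 - monom 1 l) * (monom 1 1 * pderiv P)"
    by (simp only: sum_subtractf sum_Q sum_distrib_left[symmetric])
      (simp add: x_pderiv_rest[unfolded One_nat_def] algebra_simps)
  finally have join: "(\<Sum>b\<in>A - C. cycle_poly (\<pi> \<circ> transpose b a) A) =
      (of_nat (card A) - of_nat l) * P - (1 - monom 1 l) * (monom 1 1 * pderiv P)" .
  have "monom 1 1 * pderiv (1 - monom 1 l) = - (of_nat l * monom 1 l :: rat poly)"
    by (cases l) (simp_all add: pderiv_diff pderiv_monom mult_monom of_nat_monom)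
  then have deriv: "monom 1 1 * pderiv (cycle_poly \<pi> A) =
      (1 - monom 1 l) * (monom 1 1 * pderiv P) - P * (of_nat l * monom 1 l)"
    unfolding cycle_poly_eq pderiv_mult by algebra
  show ?thesis
    unfolding sum_over_transpositions cut join deriv unfolding cycle_poly_eq hook_poly_def G_def[symmetric]
    by algebra
qed

text \<open>This dictates \<open>arm_poly\<close>. Write g for the hook polynomial and K for |A| -
  1. If g = y + w, where the sum sends y to K y - x y' and w to -x w', then it sends g to K y - x
  g'; comparison forces K (1 - x) y = |A| P - g.\<close>

lemma hook_poly_sum:
  "(1 - monom 1 1) * (\<Sum>b\<in>A - {a}. hook_poly (\<pi> \<circ> transpose b a) A a) =
     of_nat (card A) * P - hook_poly \<pi> A a
       - (1 - monom 1 1) * (monom 1 1 * pderiv (hook_poly \<pi> A a))"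
proof -
  have "(1 - monom 1 1) * (\<Sum>b\<in>A - {a}. hook_poly (\<pi> \<circ> transpose b a) A a) =
      (\<Sum>b\<in>A - {a}. cycle_poly (\<pi> \<circ> transpose b a) A)"
    unfolding sum_distrib_left
    by (intro sum.cong pointed_permutation.hook_poly_mult pointed_permutation_comp) auto
  moreover have "pderiv (cycle_poly \<pi> A) =
      (1 - monom 1 1) * pderiv (hook_poly \<pi> A a) - hook_poly \<pi> A a"
    unfolding hook_poly_mult[symmetric] pderiv_mult
    by (simp add: pderiv_diff pderiv_monom monom_0)
  ultimately show ?thesis
    unfolding cycle_poly_sum hook_poly_mult[symmetric] by algebra
qed

lemma poly_rest_1: "poly P 1 = (if C = A then 1 else 0)"
proof (cases "C = A")
  case True
  then show ?thesis
    by (simp add: rest_poly_def cycle_poly_def)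
next
  case False
  then obtain b where "b \<in> A - C"
    using a orbit_subset_A by blast
  then have "orbit \<pi> b \<in> Ds"
    by simp
  then show ?thesis
    using False finite_Ds
    by (auto simp: rest_poly_def cycle_poly_def poly_prod poly_monom)
qed

text \<open>Any cycle other than that of \<open>a\<close> contributes a factor that vanishes at 1,
  so evaluation at 1 detects long cycles.\<close>

lemma poly_hook_1: "poly (hook_poly \<pi> A a) 1 = (if C = A then of_nat (card A) else 0)"
  by (simp add: hook_poly_def poly_rest_1 poly_sum poly_monom)

end

section \<open>Splitting the hook polynomial into arm and leg\<close>

lemma poly_dvd_if_root_1:
  fixes p :: "rat poly"
  assumes "poly p 1 = 0"
  shows "(1 - monom 1 1) dvd p"
proof -
  have "(1 - monom 1 1 :: rat poly) = - [:- 1, 1:]"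
    by (simp add: monom_Suc one_pCons)
  then show ?thesis
    using assms by (simp only: minus_dvd_iff) (simp add: poly_eq_0_iff_dvd)
qed

lemma one_minus_x_nonzero: "(1 - monom 1 1 :: rat poly) \<noteq> 0"
proof
  assume "(1 - monom 1 1 :: rat poly) = 0"
  then have "coeff (1 - monom 1 1 :: rat poly) 0 = coeff 0 0"
    by (simp only:)
  then show False
    by simp
qed

text \<open>
  The hook characters restricted to the stabilizer of \<open>a\<close> split in two, according to whether the
  box of \<open>a\<close> lies in the arm or in the leg; on each part the Jucys--Murphy element of \<open>a\<close>
  acts by the content of that box.
\<close>

definition arm_poly :: "('a \<Rightarrow> 'a) \<Rightarrow> 'a set \<Rightarrow> 'a \<Rightarrow> rat poly"
  where "arm_poly \<pi> A a = smult (1 / of_nat (card A - 1))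
    ((of_nat (card A) * rest_poly \<pi> A a - hook_poly \<pi> A a) div (1 - monom 1 1))"

definition leg_poly :: "('a \<Rightarrow> 'a) \<Rightarrow> 'a set \<Rightarrow> 'a \<Rightarrow> rat poly"
  where "leg_poly \<pi> A a = hook_poly \<pi> A a - arm_poly \<pi> A a"

context pointed_permutation
begin

lemma arm_poly_mult:
  assumes "1 < card A"
  shows "of_nat (card A - 1) * ((1 - monom 1 1) * arm_poly \<pi> A a) =
    of_nat (card A) * P - hook_poly \<pi> A a"
proof -
  let ?p = "of_nat (card A) * P - hook_poly \<pi> A a"
  \<comment> \<open>On a long cycle both terms are |A| at 1, otherwise both are 0; hence the
    \<open>div\<close> in \<open>arm_poly\<close> is exact.\<close>
  have "poly ?p 1 = 0"
    by (simp add: poly_rest_1 poly_hook_1)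
  then have "(1 - monom 1 1) * (?p div (1 - monom 1 1)) = ?p"
    by (intro dvd_mult_div_cancel poly_dvd_if_root_1)
  then have "smult (1 / of_nat (card A - 1)) ?p = (1 - monom 1 1) * arm_poly \<pi> A a"
    by (simp only: arm_poly_def mult_smult_right)
  then have "of_nat (card A - 1) * ((1 - monom 1 1) * arm_poly \<pi> A a) =
      smult (of_nat (card A - 1)) (smult (1 / of_nat (card A - 1)) ?p)"
    by (simp only:) (simp add: of_nat_poly)
  then show ?thesis
    using assms by simp
qed

text \<open>The relation K (1 - x) y = |A| P - g transports the sums known for P and g to y.
  Differentiating it supplies y', after which K (1 - x) is cancelled.\<close>

lemma arm_poly_sum:
  assumes "1 < card A"
  shows "(\<Sum>b\<in>A - {a}. arm_poly (\<pi> \<circ> transpose b a) A a) =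
    of_nat (card A - 1) * arm_poly \<pi> A a - monom 1 1 * pderiv (arm_poly \<pi> A a)"
proof -
  define N K X :: "rat poly" where NKX: "N = of_nat (card A)" "K = of_nat (card A - 1)" "X = monom 1 1"
  define S where "S = (\<Sum>b\<in>A - {a}. arm_poly (\<pi> \<circ> transpose b a) A a)"
  define T where "T = (\<Sum>b\<in>A - {a}. hook_poly (\<pi> \<circ> transpose b a) A a)"
  let ?y = "arm_poly \<pi> A a" and ?g = "hook_poly \<pi> A a"
  have K: "K = N - 1"
    using assms by (simp add: NKX of_nat_diff)
  have nz: "K \<noteq> 0" "1 - X \<noteq> 0"
    using assms one_minus_x_nonzero by (simp_all add: NKX)
  have y: "K * ((1 - X) * ?y) = N * P - ?g"
    unfolding NKX by (rule arm_poly_mult[OF assms])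
  have "pderiv (K * ((1 - X) * ?y)) = pderiv (N * P - ?g)"
    by (simp only: y)
  moreover have "pderiv K = 0" "pderiv N = 0" "pderiv (1 - X) = - 1"
    by (simp_all add: NKX pderiv_diff pderiv_monom monom_0 one_pCons)
  ultimately have y': "K * ((1 - X) * pderiv ?y - ?y) = N * pderiv P - pderiv ?g"
    by (simp add: pderiv_mult pderiv_diff algebra_simps)
  have T: "(1 - X) * T = N * P - ?g - (1 - X) * (X * pderiv ?g)"
    unfolding NKX T_def by (rule hook_poly_sum)
  have "(1 - X) * T = (1 - X) * (K * ?y - X * pderiv ?g)"
    using T y by algebra
  then have T': "T = K * ?y - X * pderiv ?g"
    using nz(2) by simp
  have "K * ((1 - X) * S) = (\<Sum>b\<in>A - {a}. N * rest_poly (\<pi> \<circ> transpose b a) A a -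
      hook_poly (\<pi> \<circ> transpose b a) A a)"
    unfolding S_def sum_distrib_left NKX
    by (intro sum.cong pointed_permutation.arm_poly_mult pointed_permutation_comp assms) auto
  also have "\<dots> = N * (N * P - ?g - X * pderiv P) - T"
    by (simp only: sum_subtractf sum_distrib_left[symmetric] rest_poly_sum NKX T_def)
  finally have "K * ((1 - X) * S) = K * ((1 - X) * (K * ?y - X * pderiv ?y))"
    using T' y y' K by algebra
  then have "S = K * ?y - X * pderiv ?y"
    using nz by simp
  then show ?thesis
    unfolding S_def NKX .
qed

lemma leg_poly_sum:
  assumes "1 < card A"
  shows "(\<Sum>b\<in>A - {a}. leg_poly (\<pi> \<circ> transpose b a) A a) =
    - (monom 1 1 * pderiv (leg_poly \<pi> A a))"
proof -
  let ?T = "\<Sum>b\<in>A - {a}. hook_poly (\<pi> \<circ> transpose b a) A a"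
  have "(1 - monom 1 1) * ?T = (1 - monom 1 1) * (of_nat (card A - 1) * arm_poly \<pi> A a
      - monom 1 1 * pderiv (hook_poly \<pi> A a))"
    using hook_poly_sum arm_poly_mult[OF assms] by algebra
  then have "?T = of_nat (card A - 1) * arm_poly \<pi> A a
      - monom 1 1 * pderiv (hook_poly \<pi> A a)"
    using one_minus_x_nonzero by (simp only: mult_cancel_left simp_thms)
  then show ?thesis
    unfolding leg_poly_def sum_subtractf arm_poly_sum[OF assms] pderiv_diff by algebra
qed

text \<open>The branching rule for hooks. With \<open>a\<close> fixed, g = P = (1 - x) h for the
  hook polynomial h of the smaller set; the arm part is h, and the leg part -x h carries the shift
  of r by one.\<close>

lemma arm_leg_poly_fixed:
  assumes "\<pi> a = a" "b \<in> A - {a}"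
  shows "arm_poly \<pi> A a = hook_poly \<pi> (A - {a}) b"
    and "leg_poly \<pi> A a = - (monom 1 1 * hook_poly \<pi> (A - {a}) b)"
proof -
  let ?h = "hook_poly \<pi> (A - {a}) b"
  have "\<pi> permutes (A - {a})"
    by (rule permutes_superset[OF permutes]) (use assms(1) in auto)
  then interpret r: pointed_permutation "A - {a}" \<pi> b
    using finite assms(2) by unfold_locales auto
  have C: "C = {a}"
    using assms(1) by (simp add: orbit_eq_singleton_iff)
  have P: "P = (1 - monom 1 1) * ?h"
    unfolding r.hook_poly_mult rest_poly_def C ..
  have g: "hook_poly \<pi> A a = P"
    by (simp add: hook_poly_def C)
  have "card {b, a} \<le> card A"
    using a assms(2) finite by (intro card_mono) auto
  then have N: "1 < card A"
    using assms(2) by simp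
  have "of_nat (card A) = (of_nat (card A - 1) + 1 :: rat poly)"
    using N by (simp add: of_nat_diff)
  then have "of_nat (card A - 1) * ((1 - monom 1 1) * arm_poly \<pi> A a) =
      of_nat (card A - 1) * ((1 - monom 1 1) * ?h)"
    unfolding arm_poly_mult[OF N] g unfolding P by algebra
  then show arm: "arm_poly \<pi> A a = ?h"
    using N one_minus_x_nonzero by (simp only: mult_cancel_left of_nat_eq_0_iff) simp
  show "leg_poly \<pi> A a = - (monom 1 1 * ?h)"
    unfolding leg_poly_def g arm unfolding P by algebra
qed

end

section \<open>Generating functions\<close>

text \<open>This is z^k times the falling factorial of a/z, written without division so that z may
  be \<open>fps_X\<close>.\<close>

definition step_falling :: "'a::comm_ring_1 \<Rightarrow> 'a \<Rightarrow> nat \<Rightarrow> 'a"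
  where "step_falling z a k = (\<Prod>j<k. a - of_nat j * z)"

lemma sum_binomial_Suc:
  fixes f :: "nat \<Rightarrow> 'a::comm_semiring_1"
  shows "(\<Sum>k\<le>Suc n. of_nat (Suc n choose k) * f k) =
    (\<Sum>k\<le>n. of_nat (n choose k) * f k) + (\<Sum>k\<le>n. of_nat (n choose k) * f (Suc k))"
proof -
  have "(\<Sum>k\<le>Suc n. of_nat (Suc n choose k) * f k) =
      f 0 + (\<Sum>k\<le>n. of_nat (n choose Suc k) * f (Suc k)) +
      (\<Sum>k\<le>n. of_nat (n choose k) * f (Suc k))"
    by (simp only: sum.atMost_Suc_shift binomial_Suc_Suc)
      (simp add: distrib_right sum.distrib add_ac)
  also have "f 0 + (\<Sum>k\<le>n. of_nat (n choose Suc k) * f (Suc k)) =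
      (\<Sum>k\<le>Suc n. of_nat (n choose k) * f k)"
    by (simp only: sum.atMost_Suc_shift) simp
  also have "\<dots> = (\<Sum>k\<le>n. of_nat (n choose k) * f k)"
    by (simp add: binomial_eq_0)
  finally show ?thesis .
qed

lemma step_falling_Vandermonde:
  "step_falling z (a + b) n =
     (\<Sum>k\<le>n. of_nat (n choose k) * (step_falling z a k * step_falling z b (n - k)))"
proof (induction n)
  case 0
  then show ?case by (simp add: step_falling_def)
next
  case (Suc n)
  let ?f = "step_falling z"
  have Suc': "?f c (Suc k) = ?f c k * (c - of_nat k * z)" for c k
    by (simp add: step_falling_def)
  have "?f (a + b) (Suc n) = (\<Sum>k\<le>n. of_nat (n choose k) * (?f a k * ?f b (n - k))) *
      (a + b - of_nat n * z)"
    by (simp only: Suc' Suc.IH)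
  also have "\<dots> = (\<Sum>k\<le>n. of_nat (n choose k) * (?f a k * ?f b (Suc n - k))
      + of_nat (n choose k) * (?f a (Suc k) * ?f b (Suc n - Suc k)))"
    unfolding sum_distrib_right
  proof (rule sum.cong)
    fix k assume "k \<in> {..n}"
    \<comment> \<open>Splits the new factor as (a - k z) + (b - (n - k) z), one summand extending
      each falling factorial.\<close>
    then have "Suc n - k = Suc (n - k)" "of_nat n * z = of_nat k * z + of_nat (n - k) * z"
      by (simp_all add: Suc_diff_le distrib_right[symmetric] of_nat_add[symmetric] del: of_nat_add)
    then show "of_nat (n choose k) * (?f a k * ?f b (n - k)) * (a + b - of_nat n * z) =
        of_nat (n choose k) * (?f a k * ?f b (Suc n - k))
        + of_nat (n choose k) * (?f a (Suc k) * ?f b (Suc n - Suc k))"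
      by (simp add: Suc' algebra_simps)
  qed simp
  also have "\<dots> = (\<Sum>k\<le>Suc n. of_nat (Suc n choose k) * (?f a k * ?f b (Suc n - k)))"
    by (simp only: sum.distrib sum_binomial_Suc)
  finally show ?case .
qed

definition content_factor :: "int \<Rightarrow> rat fps"
  where "content_factor c = 1 - of_int c * fps_X"

text \<open>The contents of the cells of the hook $(n - r, 1^r)$ are the integers from $-r$ to $n - r - 1$.\<close>

definition hook_contents :: "nat \<Rightarrow> nat \<Rightarrow> rat fps"
  where "hook_contents n r = (\<Prod>c\<in>{- int r..<int n - int r}. content_factor c)"

lemma hook_contents_arm:
  "hook_contents (Suc n) r = hook_contents n r * content_factor (int n - int r)"
proof -
  have "{- int r..<int (Suc n) - int r} = insert (int n - int r) {- int r..<int n - int r}"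
    by auto
  then show ?thesis
    by (simp add: hook_contents_def mult.commute)
qed

lemma hook_contents_leg:
  "hook_contents (Suc n) (Suc r) = hook_contents n r * content_factor (- int (Suc r))"
proof -
  have "{- int (Suc r)..<int (Suc n) - int (Suc r)} =
      insert (- int (Suc r)) {- int r..<int n - int r}"
    by auto
  then show ?thesis
    by (simp add: hook_contents_def mult.commute)
qed

text \<open>Pairing c with -c produces the squares; c = 0 contributes 1.\<close>

lemma prod_symmetric_contents:
  "(\<Prod>c\<in>{- int N..int N}. content_factor c) =
     (\<Prod>i = 1..N. 1 - fps_const (of_nat (i ^ 2)) * fps_X ^ 2)"
proof (induction N)
  case 0
  then show ?case by (simp add: content_factor_def)
next
  case (Suc N)
  have "{- int (Suc N)..int (Suc N)} =
      insert (- int (Suc N)) (insert (int (Suc N)) {- int N..int N})"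
    by auto
  then have "(\<Prod>c\<in>{- int (Suc N)..int (Suc N)}. content_factor c) =
      (content_factor (- int (Suc N)) * content_factor (int (Suc N))) *
      (\<Prod>c\<in>{- int N..int N}. content_factor c)"
    by (simp add: mult.assoc del: of_nat_Suc)
  also have "content_factor (- int (Suc N)) * content_factor (int (Suc N)) =
      1 - fps_const (of_nat (Suc N ^ 2)) * fps_X ^ 2"
  proof -
    have "content_factor (int k) = 1 - of_nat k * fps_X"
      "content_factor (- int k) = 1 + of_nat k * fps_X"
      "(fps_const (of_nat (k ^ 2)) :: rat fps) = of_nat k ^ 2" for k
      by (simp_all only: content_factor_def fps_of_nat of_int_minus of_int_of_nat_eq
          mult_minus_left diff_minus_eq_add) (simp only: of_nat_power)
    then show ?thesis
      by (simp only: power2_eq_square ring_distribs) (simp add: algebra_simps)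
  qed
  finally show ?case
    unfolding Suc.IH by (simp add: mult.commute)
qed

text \<open>The r missing contents above the hook give factors 1 - (N - j) z, each negated to N z -
  1 - j z. The resulting sign cancels the one in the hook series, and the arguments N z - 1 and 1 +
  N z have a sum without constant term.\<close>

lemma prod_symmetric_contents_split:
  assumes "r \<le> N"
  shows "(\<Prod>c\<in>{- int N..int N}. content_factor c) =
    hook_contents (Suc N) r * ((-1) ^ r * (step_falling fps_X (of_nat N * fps_X - 1) r *
      step_falling fps_X (1 + of_nat N * fps_X) (N - r)))"
proof -
  let ?L = "{- int N..<- int r}" and ?M = "{- int r..<int (Suc N) - int r}"
    and ?R = "{int (Suc N) - int r..int N}"
  have "{- int N..int N} = (?L \<union> ?M) \<union> ?R"
    using assms by auto
  moreover have "prod content_factor (?L \<union> ?M \<union> ?R) =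
      prod content_factor (?L \<union> ?M) * prod content_factor ?R"
    by (rule prod.union_disjoint) (use assms in auto)
  moreover have "prod content_factor (?L \<union> ?M) = prod content_factor ?L * prod content_factor ?M"
    by (rule prod.union_disjoint) auto
  ultimately have "(\<Prod>c\<in>{- int N..int N}. content_factor c) =
      (\<Prod>c\<in>?L. content_factor c) * hook_contents (Suc N) r * (\<Prod>c\<in>?R. content_factor c)"
    by (simp only: hook_contents_def)
  moreover have "(\<Prod>c\<in>?L. content_factor c) =
      step_falling fps_X (1 + of_nat N * fps_X) (N - r)"
    unfolding step_falling_def
    by (rule prod.reindex_bij_witness[of _ "\<lambda>j. int j - int N" "\<lambda>c. nat (c + int N)"])
      (use assms in \<open>auto simp: content_factor_def algebra_simps\<close>)
  moreover have "(\<Prod>c\<in>?R. content_factor c) =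
      (-1) ^ r * step_falling fps_X (of_nat N * fps_X - 1) r"
  proof -
    have "(\<Prod>c\<in>?R. content_factor c) = (\<Prod>j<r. - 1 * (of_nat N * fps_X - 1 - of_nat j * fps_X))"
      by (rule prod.reindex_bij_witness[of _ "\<lambda>j. int N - int j" "\<lambda>c. nat (int N - c)"])
        (use assms in \<open>auto simp: content_factor_def algebra_simps\<close>)
    then show ?thesis
      unfolding prod.distrib step_falling_def by simp
  qed
  ultimately show ?thesis
    by (simp add: mult_ac)
qed

text \<open>After clearing denominators the sum is a Vandermonde sum, equal to the falling factorial
  of 2 N z with step z, that is z^N (2N)!/N!.\<close>

lemma hook_sum_evaluation:
  fixes G :: "nat \<Rightarrow> rat fps"
  assumes "\<And>r. r \<le> N \<Longrightarrow> G r * hook_contents (Suc N) r = (-1) ^ r * of_nat (N choose r)"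
  shows "(\<Sum>r\<le>N. G r) * (\<Prod>i = 1..N. 1 - fps_const (of_nat (i ^ 2)) * fps_X ^ 2) =
    fps_const (fact (2 * N) / fact N) * fps_X ^ N"
proof -
  let ?f = "step_falling (fps_X :: rat fps)"
  have "(\<Sum>r\<le>N. G r) * (\<Prod>c\<in>{- int N..int N}. content_factor c) =
      (\<Sum>r\<le>N. of_nat (N choose r) * (?f (of_nat N * fps_X - 1) r *
        ?f (1 + of_nat N * fps_X) (N - r)))"
    unfolding sum_distrib_right
  proof (rule sum.cong)
    fix r assume "r \<in> {..N}"
    then have r: "r \<le> N" by simp
    let ?s = "?f (of_nat N * fps_X - 1) r * ?f (1 + of_nat N * fps_X) (N - r)"
    have "G r * (\<Prod>c\<in>{- int N..int N}. content_factor c) =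
        (G r * hook_contents (Suc N) r) * ((-1) ^ r * ?s)"
      by (simp only: prod_symmetric_contents_split[OF r] mult.assoc)
    also have "\<dots> = ((-1) ^ r * (-1) ^ r) * (of_nat (N choose r) * ?s)"
      by (simp only: assms[OF r] mult_ac)
    finally show "G r * (\<Prod>c\<in>{- int N..int N}. content_factor c) = of_nat (N choose r) * ?s"
      by (simp add: power_mult_distrib[symmetric])
  qed simp
  also have "\<dots> = ?f (of_nat (2 * N) * fps_X) N"
    unfolding step_falling_Vandermonde[symmetric] by (simp add: algebra_simps)
  also have "\<dots> = (\<Prod>j<N. of_nat (2 * N - j) * fps_X)"
    unfolding step_falling_def by (intro prod.cong) (auto simp: of_nat_diff left_diff_distrib)
  also have "\<dots> = of_nat (\<Prod>j<N. 2 * N - j) * fps_X ^ N"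
    by (simp add: prod.distrib)
  also have "(\<Prod>j<N. 2 * N - j) = \<Prod>{N + 1..2 * N}"
    by (rule prod.reindex_bij_witness[of _ "\<lambda>c. 2 * N - c" "\<lambda>j. 2 * N - j"]) auto
  also have "(of_nat (\<Prod>{N + 1..2 * N}) :: rat fps) = fps_const (fact (2 * N) / fact N)"
  proof -
    have "fact (2 * N) = fact N * \<Prod>{N + 1..2 * N}"
      using fact_eq_fact_times[of N "2 * N"] by simp
    then have "(of_nat (fact (2 * N)) :: rat) = of_nat (fact N * \<Prod>{N + 1..2 * N})"
      by (simp only:)
    then have "(of_nat (\<Prod>{N + 1..2 * N}) :: rat) = fact (2 * N) / fact N"
      by (simp add: field_simps del: of_nat_prod)
    then show ?thesis
      by (simp only: fps_of_nat[symmetric])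
  qed
  finally show ?thesis
    unfolding prod_symmetric_contents .
qed

section \<open>The generating function of the central factorial numbers\<close>

lemma complete_homogeneous_0: "complete_homogeneous 0 m x = 1"
proof -
  have "{js. length js = 0 \<and> sorted js \<and> set js \<subseteq> {1..m}} = {[]}"
    by auto
  then show ?thesis
    by (simp add: complete_homogeneous_def)
qed

lemma complete_homogeneous_Suc_0: "complete_homogeneous (Suc g) 0 x = 0"
proof -
  have "{js. length js = Suc g \<and> sorted js \<and> set js \<subseteq> {1..0::nat}} = {}"
    by auto
  then show ?thesis
    by (simp only: complete_homogeneous_def sum.empty)
qed

lemma complete_homogeneous_Suc_Suc:
  "complete_homogeneous (Suc g) (Suc m) x =
     complete_homogeneous (Suc g) m x + x (Suc m) * complete_homogeneous g (Suc m) x"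
proof -
  let ?S = "\<lambda>g m. {js. length js = g \<and> sorted js \<and> set js \<subseteq> {1..m::nat}}"
  have fin: "finite (?S g m)" for g m
    by (rule finite_subset[OF _ finite_lists_length_eq[OF finite_atLeastAtMost[of 1 m], where n = g]]) auto
  have "?S (Suc g) (Suc m) = ?S (Suc g) m \<union> (\<lambda>js. js @ [Suc m]) ` ?S g (Suc m)"
  proof (intro equalityI subsetI)
    fix js assume js: "js \<in> ?S (Suc g) (Suc m)"
    then obtain ks j where ks: "js = ks @ [j]"
      by (cases js rule: rev_cases) auto
    show "js \<in> ?S (Suc g) m \<union> (\<lambda>js. js @ [Suc m]) ` ?S g (Suc m)"
    proof (cases "j = Suc m")
      case True
      then show ?thesis
        using js by (auto simp: ks sorted_append)
    next
      case False
      then show ?thesis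
        using js by (fastforce simp: ks sorted_append)
    qed
  qed (fastforce simp: sorted_append)
  moreover have "?S (Suc g) m \<inter> (\<lambda>js. js @ [Suc m]) ` ?S g (Suc m) = {}"
    by auto
  ultimately have "complete_homogeneous (Suc g) (Suc m) x = complete_homogeneous (Suc g) m x +
      (\<Sum>js\<in>(\<lambda>js. js @ [Suc m]) ` ?S g (Suc m). prod_list (map x js))"
    unfolding complete_homogeneous_def using fin
    by (simp only:) (intro sum.union_disjoint finite_imageI)
  also have "(\<Sum>js\<in>(\<lambda>js. js @ [Suc m]) ` ?S g (Suc m). prod_list (map x js)) =
      x (Suc m) * complete_homogeneous g (Suc m) x"
    unfolding complete_homogeneous_def sum_distrib_left
    by (subst sum.reindex) (auto simp: inj_on_def mult.commute intro!: sum.cong)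
  finally show ?thesis .
qed

text \<open>The variable u is replaced by z^2, so h_g stands at exponent 2g and odd exponents get 0.
  By the recurrence, multiplication by the factor of m + 1 turns the series for m + 1 into the one
  for m.\<close>

lemma central_factorial_gf:
  "Abs_fps (\<lambda>k. if even k then of_nat (complete_homogeneous (k div 2) m (\<lambda>i. i ^ 2)) else 0) *
     (\<Prod>i = 1..m. 1 - fps_const (of_nat (i ^ 2)) * fps_X ^ 2) = (1 :: rat fps)"
proof (induction m)
  case 0
  have "(if even k then of_nat (complete_homogeneous (k div 2) 0 (\<lambda>i. i ^ 2)) else 0) =
      (if k = 0 then 1 else 0 :: rat)" for k
    by (cases "k div 2") (auto simp: complete_homogeneous_0 complete_homogeneous_Suc_0)
  then show ?case
    by (simp add: fps_eq_iff)
next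
  case (Suc m)
  let ?H = "\<lambda>m. Abs_fps (\<lambda>k. if even k
    then of_nat (complete_homogeneous (k div 2) m (\<lambda>i. i ^ 2)) else 0) :: rat fps"
  have "?H (Suc m) * (1 - fps_const (of_nat (Suc m ^ 2)) * fps_X ^ 2) = ?H m"
  proof (rule fps_ext)
    fix k
    have "fps_nth (?H (Suc m) * (1 - fps_const (of_nat (Suc m ^ 2)) * fps_X ^ 2)) k =
        fps_nth (?H (Suc m)) k - of_nat (Suc m ^ 2) * (if k < 2 then 0 else fps_nth (?H (Suc m)) (k - 2))"
      by (simp add: right_diff_distrib mult.left_commute[of _ "fps_const _"] fps_X_power_mult_right_nth
          del: of_nat_power of_nat_Suc power_Suc)
    also have "\<dots> = fps_nth (?H m) k"
    proof (cases "k < 2")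
      case True
      then have "k = 0 \<or> k = 1" by auto
      then show ?thesis
        by (auto simp: complete_homogeneous_0)
    next
      case False
      then obtain j where "k = Suc (Suc j)"
        by (metis Suc_1 add_2_eq_Suc le_Suc_ex not_less)
      then show ?thesis
        by (simp add: complete_homogeneous_Suc_Suc)
    qed
    finally show "fps_nth (?H (Suc m) * (1 - fps_const (of_nat (Suc m ^ 2)) * fps_X ^ 2)) k = fps_nth (?H m) k" .
  qed
  moreover have "{1..Suc m} = insert (Suc m) {1..m}"
    by auto
  ultimately show ?case
    using Suc.IH by (simp add: mult.assoc[symmetric] del: of_nat_power of_nat_Suc)
qed

section \<open>The hook expansion\<close>

text \<open>The value of the linear extension of \<phi> at the group algebra element h_k(J_2, ...,
  J_n).\<close>

definition pairing :: "nat \<Rightarrow> nat \<Rightarrow> ((nat \<Rightarrow> nat) \<Rightarrow> rat poly) \<Rightarrow> rat poly"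
  where "pairing n k \<phi> = (\<Sum>\<pi> | \<pi> permutes {1..n}. smult (prim_count n k \<pi>) (\<phi> \<pi>))"

lemma pairing_0: "pairing n 0 \<phi> = \<phi> id"
proof -
  have "pairing n 0 \<phi> = (\<Sum>\<pi> | \<pi> permutes {1..n}. if id = \<pi> then \<phi> \<pi> else 0)"
    unfolding pairing_def by (intro sum.cong) (auto simp: prim_count_0)
  also have "\<dots> = \<phi> id"
    using permutes_id[of "{1..n}"] by (subst sum.delta') (auto simp: finite_permutations)
  finally show ?thesis .
qed

lemma pairing_cong:
  assumes "\<And>\<pi>. \<pi> permutes {1..n} \<Longrightarrow> \<phi> \<pi> = \<psi> \<pi>"
  shows "pairing n k \<phi> = pairing n k \<psi>"
  unfolding pairing_def by (intro sum.cong) (auto simp: assms)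

lemma pairing_add: "pairing n k (\<lambda>\<pi>. \<phi> \<pi> + \<psi> \<pi>) = pairing n k \<phi> + pairing n k \<psi>"
  by (simp add: pairing_def smult_add_right sum.distrib)

lemma smult_sum_right: "smult c (sum f S) = (\<Sum>x\<in>S. smult c (f x))"
  for c :: rat
  by (induction S rule: infinite_finite_induct) (simp_all add: smult_add_right)

text \<open>The operator \<open>jm m\<close> moves from the counts to \<phi> because \<pi> \<mapsto>
  \<pi> \<circ> (s m+1) is an involution of the permutations of {1..m+1}.\<close>

lemma pairing_Suc: "pairing (Suc m) (Suc k) \<phi> = pairing m (Suc k) \<phi> + pairing (Suc m) k (jm m \<phi>)"
proof -
  let ?S = "{\<pi>. \<pi> permutes {1..Suc m}}" and ?c = "prim_count (Suc m) k"
  have "(\<Sum>\<pi>\<in>?S. smult (prim_count m (Suc k) \<pi>) (\<phi> \<pi>)) = pairing m (Suc k) \<phi>"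
    unfolding pairing_def
    by (rule sum.mono_neutral_right)
      (auto simp: finite_permutations prim_count_eq_0 intro: permutes_subset)
  moreover have "(\<Sum>\<pi>\<in>?S. smult (jm m ?c \<pi>) (\<phi> \<pi>)) = pairing (Suc m) k (jm m \<phi>)"
  proof -
    have "(\<Sum>\<pi>\<in>?S. smult (jm m ?c \<pi>) (\<phi> \<pi>)) =
        (\<Sum>s\<in>{1..m}. \<Sum>\<pi>\<in>?S. smult (?c (\<pi> \<circ> transpose s (Suc m))) (\<phi> \<pi>))"
      unfolding jm_def smult_sum by (rule sum.swap)
    also have "\<dots> = (\<Sum>s\<in>{1..m}. \<Sum>\<pi>\<in>?S. smult (?c \<pi>) (\<phi> (\<pi> \<circ> transpose s (Suc m))))"
    proof (rule sum.cong)
      fix s assume s: "s \<in> {1..m}"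
      have inv: "\<pi> \<circ> transpose s (Suc m) \<circ> transpose s (Suc m) = \<pi>" for \<pi> :: "nat \<Rightarrow> nat"
        by (simp only: comp_assoc transpose_comp_involutory comp_id)
      have "\<pi> \<circ> transpose s (Suc m) \<in> ?S" if "\<pi> \<in> ?S" for \<pi>
        using that s by (auto intro!: permutes_compose permutes_swap_id)
      then show "(\<Sum>\<pi>\<in>?S. smult (?c (\<pi> \<circ> transpose s (Suc m))) (\<phi> \<pi>)) =
          (\<Sum>\<pi>\<in>?S. smult (?c \<pi>) (\<phi> (\<pi> \<circ> transpose s (Suc m))))"
        by (intro sum.reindex_bij_witness[of _ "\<lambda>\<pi>. \<pi> \<circ> transpose s (Suc m)"
              "\<lambda>\<pi>. \<pi> \<circ> transpose s (Suc m)"]) (simp_all only: inv)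
    qed simp
    also have "\<dots> = pairing (Suc m) k (jm m \<phi>)"
      unfolding pairing_def jm_def smult_sum_right by (rule sum.swap)
    finally show ?thesis .
  qed
  ultimately show ?thesis
    unfolding pairing_def[of "Suc m" "Suc k"] prim_count_Suc_jm smult_add_left sum.distrib
    by (simp only:)
qed

lemma pairing_0_Suc: "pairing 0 (Suc k) \<phi> = 0"
proof -
  have "primitive_factorizations 0 \<pi> (Suc k) = {}" for \<pi>
    by (auto simp: primitive_factorizations_def transposition_factorizations_def length_Suc_conv)
  then show ?thesis
    by (simp add: pairing_def prim_count_def)
qed

definition pairing_series :: "nat \<Rightarrow> ((nat \<Rightarrow> nat) \<Rightarrow> rat poly) \<Rightarrow> nat \<Rightarrow> rat fps"
  where "pairing_series n \<phi> r = Abs_fps (\<lambda>k. coeff (pairing n k \<phi>) r)"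

text \<open>If J_{m+1} acts by the scalar c, the recursion reads F_{m+1} = F_m + c z F_{m+1}; the
  constant terms agree, as both come from \<phi> at the identity.\<close>

lemma pairing_series_content:
  assumes "\<And>\<pi>. \<pi> permutes {1..Suc m} \<Longrightarrow> coeff (jm m \<phi> \<pi>) r = of_int c * coeff (\<phi> \<pi>) r"
  shows "pairing_series (Suc m) \<phi> r * content_factor c = pairing_series m \<phi> r"
proof (rule fps_ext)
  fix k
  have jm: "coeff (pairing (Suc m) k (jm m \<phi>)) r = of_int c * coeff (pairing (Suc m) k \<phi>) r" for k
    unfolding pairing_def coeff_sum sum_distrib_left by (intro sum.cong) (auto simp: assms)
  have "pairing_series (Suc m) \<phi> r * content_factor c =
      pairing_series (Suc m) \<phi> r - fps_const (of_int c) * (pairing_series (Suc m) \<phi> r * fps_X)"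
    by (simp add: content_factor_def right_diff_distrib fps_of_int mult_ac)
  then show "fps_nth (pairing_series (Suc m) \<phi> r * content_factor c) k =
      fps_nth (pairing_series m \<phi> r) k"
    by (cases k) (simp_all add: pairing_series_def pairing_0 pairing_Suc jm)
qed

abbreviation hook :: "nat \<Rightarrow> (nat \<Rightarrow> nat) \<Rightarrow> rat poly"
  where "hook n \<equiv> \<lambda>\<pi>. hook_poly \<pi> {1..n} n"

lemma coeff_x_pderiv: "coeff (monom 1 1 * pderiv p) r = of_nat r * coeff p r"
  for p :: "rat poly"
  by (cases r) (simp_all add: coeff_monom_mult coeff_pderiv)

lemma coeff_content_eq:
  "coeff (of_nat m * p - monom 1 1 * pderiv p) r = of_int (int m - int r) * coeff p r"
  for p :: "rat poly"
  by (simp only: coeff_diff coeff_x_pderiv of_nat_poly)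
    (simp add: algebra_simps)

text \<open>U and V are the series of the arm and leg parts. Without the box of m + 1 the hook has
  leg r or leg r - 1; in the latter case the factor -x gives the sign, and for r = 0 there is no leg
  to shorten.\<close>

lemma hook_series_split:
  assumes "1 \<le> m"
  shows "\<exists>U V. pairing_series (Suc m) (hook (Suc m)) r = U + V \<and>
    U * content_factor (int m - int r) = pairing_series m (hook m) r \<and>
    V * content_factor (- int r) =
      - (case r of 0 \<Rightarrow> 0 | Suc q \<Rightarrow> pairing_series m (hook m) q)"
proof -
  let ?A = "{1..Suc m}" and ?a = "Suc m"
  let ?arm = "\<lambda>\<pi>. arm_poly \<pi> ?A ?a" and ?leg = "\<lambda>\<pi>. leg_poly \<pi> ?A ?a"
  have minus: "?A - {?a} = {1..m}"
    by auto
  have pointed: "pointed_permutation ?A \<pi> ?a" if "\<pi> permutes ?A" for \<pi>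
    using that by unfold_locales auto
  have "coeff (jm m ?arm \<pi>) r = of_int (int m - int r) * coeff (?arm \<pi>) r"
    if "\<pi> permutes ?A" for \<pi>
    using pointed_permutation.arm_poly_sum[OF pointed[OF that]] assms coeff_content_eq[of m "?arm \<pi>" r]
    by (simp add: jm_def minus[unfolded One_nat_def])
  then have arm: "pairing_series (Suc m) ?arm r * content_factor (int m - int r) =
      pairing_series m ?arm r"
    by (rule pairing_series_content)
  have "coeff (jm m ?leg \<pi>) r = of_int (- int r) * coeff (?leg \<pi>) r"
    if "\<pi> permutes ?A" for \<pi>
    using pointed_permutation.leg_poly_sum[OF pointed[OF that]] assms coeff_x_pderiv[of "?leg \<pi>" r]
    by (simp add: jm_def minus[unfolded One_nat_def])
  then have leg: "pairing_series (Suc m) ?leg r * content_factor (- int r) =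
      pairing_series m ?leg r"
    by (rule pairing_series_content)
  have fixed: "?arm \<pi> = hook m \<pi>" "?leg \<pi> = - (monom 1 1 * hook m \<pi>)"
    if "\<pi> permutes {1..m}" for \<pi>
  proof -
    have \<pi>: "\<pi> permutes ?A"
      using that by (rule permutes_subset) auto
    have a: "\<pi> ?a = ?a"
      using that by (rule permutes_not_in) auto
    have m: "m \<in> ?A - {?a}"
      using assms by auto
    show "?arm \<pi> = hook m \<pi>" "?leg \<pi> = - (monom 1 1 * hook m \<pi>)"
      using pointed_permutation.arm_leg_poly_fixed[OF pointed[OF \<pi>] a m]
      by (simp_all only: minus)
  qed
  have arm': "pairing_series m ?arm r = pairing_series m (hook m) r"
    unfolding pairing_series_def by (simp only: fixed cong: pairing_cong)
  have "pairing m k ?leg = - (monom 1 1 * pairing m k (hook m))" for k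
  proof -
    have "pairing m k ?leg = pairing m k (\<lambda>\<pi>. - (monom 1 1 * hook m \<pi>))"
      by (intro pairing_cong fixed)
    then show ?thesis
      by (simp add: pairing_def sum_negf sum_distrib_left)
  qed
  then have leg': "pairing_series m ?leg r =
      - (case r of 0 \<Rightarrow> 0 | Suc q \<Rightarrow> pairing_series m (hook m) q)"
    by (auto simp: pairing_series_def fps_eq_iff coeff_monom_mult split: nat.split)
  have "pairing_series (Suc m) (hook (Suc m)) r =
      pairing_series (Suc m) ?arm r + pairing_series (Suc m) ?leg r"
    unfolding pairing_series_def
    by (simp add: fps_eq_iff coeff_add[symmetric] pairing_add[symmetric] leg_poly_def del: coeff_add)
  then show ?thesis
    using arm leg arm' leg' by metis
qed

text \<open>Both ways of adding a box complete the smaller product of contents to the same larger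
  one, so the numerators add by Pascal's rule. For r > N the binomial is 0.\<close>

lemma hook_series:
  "pairing_series (Suc N) (hook (Suc N)) r * hook_contents (Suc N) r =
    (-1) ^ r * of_nat (N choose r)"
proof (induction N arbitrary: r)
  case 0
  have orb: "orbit id (1::nat) = {1}"
    by (simp add: orbit_eq_singleton_iff)
  have "hook 1 id = 1"
    unfolding hook_poly_def rest_poly_def cycle_poly_def orb by simp
  then have "pairing 1 0 (hook 1) = 1"
    by (simp only: pairing_0)
  moreover have "pairing 1 (Suc k) (hook 1) = 0" for k
    by (simp only: One_nat_def pairing_Suc pairing_0_Suc) (simp add: jm_def pairing_def)
  ultimately have "coeff (pairing 1 k (hook 1)) r = (if r = 0 \<and> k = 0 then 1 else 0)" for k
    by (cases k) (simp_all only: coeff_1 coeff_0, auto)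
  then have "pairing_series 1 (hook 1) r = (if r = 0 then 1 else 0)"
    unfolding pairing_series_def by (intro fps_ext) simp
  moreover have "hook_contents 1 0 = 1"
    using hook_contents_arm[of 0 0] by (simp add: hook_contents_def content_factor_def)
  ultimately show ?case
    by (cases r) simp_all
next
  case (Suc N)
  obtain U V where UV: "pairing_series (Suc (Suc N)) (hook (Suc (Suc N))) r = U + V"
    "U * content_factor (int (Suc N) - int r) = pairing_series (Suc N) (hook (Suc N)) r"
    "V * content_factor (- int r) =
      - (case r of 0 \<Rightarrow> 0 | Suc q \<Rightarrow> pairing_series (Suc N) (hook (Suc N)) q)"
    using hook_series_split[of "Suc N" r] by auto
  have U: "U * hook_contents (Suc (Suc N)) r = (-1) ^ r * of_nat (N choose r)"
  proof -
    have "U * hook_contents (Suc (Suc N)) r =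
        (U * content_factor (int (Suc N) - int r)) * hook_contents (Suc N) r"
      unfolding hook_contents_arm[of "Suc N"] by (simp only: mult_ac)
    then show ?thesis
      by (simp only: UV(2) Suc.IH)
  qed
  show ?case
  proof (cases r)
    case 0
    \<comment> \<open>For r = 0 the factor of V is 1, the right-hand side being 0.\<close>
    then have "V = 0"
      using UV(3) by (simp add: content_factor_def)
    then show ?thesis
      using U UV(1) 0 by simp
  next
    case (Suc q)
    have "V * hook_contents (Suc (Suc N)) r =
        (V * content_factor (- int r)) * hook_contents (Suc N) q"
      unfolding Suc hook_contents_leg[of "Suc N"] by (simp only: mult_ac)
    also have "\<dots> = (-1) ^ r * of_nat (N choose q)"
      using Suc.IH[of q] UV(3) by (simp add: Suc)
    finally show ?thesis
      using U unfolding UV(1) by (simp add: Suc distrib_right algebra_simps)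
  qed
qed

section \<open>From the hook expansion to the full cycle\<close>

lemma hook_contents_nonzero: "hook_contents n r \<noteq> 0"
proof -
  have "content_factor c \<noteq> 0" for c
  proof -
    have "fps_nth (content_factor c) 0 = 1"
      by (simp add: content_factor_def)
    then show ?thesis
      by auto
  qed
  then show ?thesis
    by (simp add: hook_contents_def)
qed

lemma poly_pairing_hook_1:
  "poly (pairing (Suc N) k (hook (Suc N))) 1 =
    (\<Sum>r\<le>N. fps_nth (pairing_series (Suc N) (hook (Suc N)) r) k)"
proof -
  let ?p = "pairing (Suc N) k (hook (Suc N))"
  \<comment> \<open>The degree bound is read off from \<open>hook_series\<close>: the binomial
    vanishes and the product of contents does not.\<close>
  have "coeff ?p r = 0" if "N < r" for r
  proof -
    have "pairing_series (Suc N) (hook (Suc N)) r * hook_contents (Suc N) r = 0"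
      using that by (simp only: hook_series) (simp add: binomial_eq_0)
    then have "fps_nth (pairing_series (Suc N) (hook (Suc N)) r) k = 0"
      using hook_contents_nonzero by simp
    then show ?thesis
      by (simp add: pairing_series_def)
  qed
  then have "degree ?p \<le> N"
    by (intro degree_le) auto
  then have "poly ?p 1 = (\<Sum>r\<le>N. coeff ?p r)"
    by (simp add: poly_altdef, intro sum.mono_neutral_left) (auto simp: coeff_eq_0)
  then show ?thesis
    by (simp add: pairing_series_def)
qed

text \<open>A long cycle is $p\,(1\,2\,\dots\,n)\,p^{-1}$ for a unique $p$ fixing $n$, namely $p(i) = \pi^i(n)$.\<close>

lemma bij_betw_long_cycles:
  fixes N :: nat
  defines "n \<equiv> Suc N"
  shows "bij_betw (\<lambda>p. p \<circ> full_cycle n \<circ> inv p) {p. p permutes {1..N}}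
    {\<pi>. \<pi> permutes {1..n} \<and> orbit \<pi> n = {1..n}}" (is "bij_betw ?f ?P ?L")
proof -
  have full: "full_cycle n i = Suc i" if "1 \<le> i" "i < n" for i
    using that full_cycle_apply[of i n] by simp
  have full_n: "full_cycle n n = 1"
    using full_cycle_apply[of n n] by (simp add: n_def)
  have sub: "p permutes {1..n}" if "p \<in> ?P" for p
    using that by (auto intro: permutes_subset simp: n_def)
  have power: "(?f p ^^ i) n = p i" if p: "p \<in> ?P" and i: "1 \<le> i" "i \<le> n" for p i
    using i
  proof (induction i)
    case (Suc i)
    have inv: "inv p (p j) = j" for j
      using sub[OF p] permutes_inverses(2) by metis
    have pn: "p n = n"
      using p by (auto simp: permutes_def n_def)
    show ?case
    proof (cases "i = 0")
      case True
      have "inv p n = n"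
        using inv[of n] pn by simp
      then show ?thesis
        using True full_n by simp
    next
      case False
      then show ?thesis
        using Suc inv full[of i] by simp
    qed
  qed simp
  have perm: "?f p permutes {1..n}" if "p \<in> ?P" for p
    using sub[OF that] full_cycle_permutes by (intro permutes_compose permutes_inv)
  have maps: "?f p \<in> ?L" if p: "p \<in> ?P" for p
  proof -
    have "i \<in> orbit (?f p) n" if "i \<in> {1..n}" for i
    proof -
      have "i \<in> p ` {1..n}"
        using that by (simp only: permutes_image[OF sub[OF p]])
      then obtain j where j: "1 \<le> j" "j \<le> n" "i = p j"
        by auto
      have "(?f p ^^ j) n = i"
        unfolding j(3) using j(1,2) by (rule power[OF p])
      then show ?thesis
        using j(1) by (subst orbit_altdef, intro CollectI exI[of _ j]) simp
    qed
    moreover have "orbit (?f p) n \<subseteq> {1..n}"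
      using perm[OF p] by (rule permutes_orbit_subset) (simp add: n_def)
    ultimately show ?thesis
      using perm[OF p] by blast
  qed
  have inj: "inj_on ?f ?P"
  proof (rule inj_onI, rule ext)
    fix p q i assume pq: "p \<in> ?P" "q \<in> ?P" "?f p = ?f q"
    show "p i = q i"
    proof (cases "i \<in> {1..n}")
      case True
      then show ?thesis
        using power[OF pq(1)] power[OF pq(2)] pq(3) by (metis atLeastAtMost_iff)
    next
      case False
      then show ?thesis
        using sub[OF pq(1)] sub[OF pq(2)] by (simp add: permutes_def)
    qed
  qed
  have surj: "\<exists>p\<in>?P. \<pi> = ?f p" if "\<pi> \<in> ?L" for \<pi>
  proof -
    have \<pi>: "\<pi> permutes {1..n}" and orb: "orbit \<pi> n = {1..n}"
      using that by auto
    have "permutation \<pi>"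
      using \<pi> permutation_permutes by blast
    note c = orbit_eq_funpow_image[OF this, of n, unfolded orb card_atLeastAtMost, simplified]
    \<comment> \<open>The identity off {1..N} makes p fix n, in agreement with the formula there:
      the n-th power of \<pi> returns n to itself.\<close>
    define p where "p i = (if i \<in> {1..N} then (\<pi> ^^ i) n else i)" for i
    have pn: "p i = (\<pi> ^^ i) n" if "i \<in> {1..n}" for i
    proof (cases "i = n")
      case True
      then show ?thesis
        using c(2) by (simp only: p_def n_def) simp
    next
      case False
      then show ?thesis
        using that by (simp add: p_def n_def)
    qed
    have "p i \<in> {1..N}" if "i \<in> {1..N}" for i
    proof -
      have "(\<pi> ^^ i) n \<in> {1..n}"
        using orb funpow_in_orbit \<open>permutation \<pi>\<close> permutation_self_in_orbit by metis
      moreover have "(\<pi> ^^ i) n \<noteq> (\<pi> ^^ 0) n"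
        using that inj_on_eq_iff[OF c(3), of i 0] by (auto simp: n_def)
      ultimately show ?thesis
        using that by (simp add: p_def n_def)
    qed
    moreover have "inj_on p {1..N}"
      using c(3) by (auto simp: p_def inj_on_def n_def)
    ultimately have "bij_betw p {1..N} {1..N}"
      by (intro bij_betw_imageI endo_inj_surj) auto
    then have p: "p permutes {1..N}"
      by (rule bij_imp_permutes) (auto simp: p_def)
    have "p (full_cycle n i) = \<pi> (p i)" for i
    proof (cases "i \<in> {1..n}")
      case True
      then consider "i = n" | "1 \<le> i" "i < n"
        by fastforce
      then show ?thesis
      proof cases
        case 1
        then show ?thesis
          using pn[of 1] full_n by (simp add: p_def n_def)
      next
        case 2
        then show ?thesis
          using pn[of "Suc i"] pn[of i] full by simp
      qed
    next
      case False
      then show ?thesis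
        using \<pi> full_cycle_permutes[of n] by (auto simp: p_def n_def permutes_def)
    qed
    then have "p \<circ> full_cycle n = \<pi> \<circ> p"
      by (simp add: fun_eq_iff)
    then have "?f p = \<pi> \<circ> (p \<circ> inv p)"
      by (simp only: comp_assoc)
    then have "\<pi> = ?f p"
      using permutes_inv_o(1)[OF p] by simp
    then show ?thesis
      using p by blast
  qed
  show ?thesis
    unfolding bij_betw_def using inj maps surj by blast
qed

text \<open>At 1 each long cycle has value n, all others 0. The N! long cycles are conjugate to the
  full cycle, so they have its count, and n N! = n!.\<close>

lemma poly_pairing_hook_full_cycle:
  "poly (pairing (Suc N) k (hook (Suc N))) 1 =
    fact (Suc N) * prim_count (Suc N) k (full_cycle (Suc N))"
proof -
  let ?n = "Suc N"
  let ?S = "{\<pi>. \<pi> permutes {1..?n}}" and ?L = "{\<pi>. \<pi> permutes {1..?n} \<and> orbit \<pi> ?n = {1..?n}}"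
  have val: "poly (hook ?n \<pi>) 1 = (if orbit \<pi> ?n = {1..?n} then of_nat ?n else 0)"
    if "\<pi> permutes {1..?n}" for \<pi>
  proof -
    interpret pointed_permutation "{1..?n}" \<pi> ?n
      using that by unfold_locales auto
    show ?thesis
      using poly_hook_1 by simp
  qed
  have "poly (pairing ?n k (hook ?n)) 1 = (\<Sum>\<pi>\<in>?S. prim_count ?n k \<pi> * poly (hook ?n \<pi>) 1)"
    by (simp add: pairing_def poly_sum)
  also have "\<dots> = (\<Sum>\<pi>\<in>?L. prim_count ?n k \<pi> * of_nat ?n)"
    using val by (intro sum.mono_neutral_cong_right) (auto simp: finite_permutations)
  also have "\<dots> = (\<Sum>p | p permutes {1..N}.
      prim_count ?n k (p \<circ> full_cycle ?n \<circ> inv p) * of_nat ?n)"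
    by (rule sum.reindex_bij_betw[OF bij_betw_long_cycles, symmetric])
  also have "\<dots> = (\<Sum>p | p permutes {1..N}. prim_count ?n k (full_cycle ?n) * of_nat ?n)"
  proof (rule sum.cong)
    fix p assume "p \<in> {p. p permutes {1..N}}"
    then have "p permutes {1..?n}"
      by (auto intro: permutes_subset)
    then show "prim_count ?n k (p \<circ> full_cycle ?n \<circ> inv p) * of_nat ?n =
        prim_count ?n k (full_cycle ?n) * of_nat ?n"
      by (simp only: prim_count_conj)
  qed simp
  also have "\<dots> = fact ?n * prim_count ?n k (full_cycle ?n)"
    by (simp add: card_permutations)
  finally show ?thesis .
qed

lemma full_cycle_gf:
  "Abs_fps (\<lambda>k. prim_count (Suc N) k (full_cycle (Suc N))) *
     (\<Prod>i = 1..N. 1 - fps_const (of_nat (i ^ 2)) * fps_X ^ 2) =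
   fps_const (catalan N) * fps_X ^ N" (is "?a * ?E = _")
proof -
  have "(\<Sum>r\<le>N. pairing_series (Suc N) (hook (Suc N)) r) = fps_const (fact (Suc N)) * ?a"
    by (rule fps_ext)
      (simp only: fps_sum_nth poly_pairing_hook_1[symmetric] poly_pairing_hook_full_cycle
        fps_mult_left_const_nth fps_nth_Abs_fps)
  then have "fps_const (fact (Suc N)) * (?a * ?E) = fps_const (fact (2 * N) / fact N) * fps_X ^ N"
    using hook_sum_evaluation[of N "pairing_series (Suc N) (hook (Suc N))"] hook_series
    by (simp only: mult.assoc)
  then have "fps_const (1 / fact (Suc N)) * (fps_const (fact (Suc N)) * (?a * ?E)) =
      fps_const (1 / fact (Suc N)) * (fps_const (fact (2 * N) / fact N) * fps_X ^ N)"
    by (simp only:)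
  then have "fps_const (1 / fact (Suc N) * fact (Suc N)) * (?a * ?E) =
      fps_const (1 / fact (Suc N) * (fact (2 * N) / fact N)) * fps_X ^ N"
    by (simp only: mult.assoc[symmetric] fps_const_mult)
  \<comment> \<open>The Catalan number as (2N)! / (N! (N+1)!).\<close>
  moreover have "1 / fact (Suc N) * (fact (2 * N) / fact N) = catalan N"
    by (simp add: catalan_def binomial_fact field_simps)
  ultimately show ?thesis
    by simp
qed

theorem theorem3:
  fixes n :: nat
  assumes "n \<ge> 1"
  shows "(\<forall>g. of_nat (card (primitive_factorizations n (full_cycle n) (n - 1 + 2 * g))) =
            catalan (n - 1) * of_nat (central_factorial (n - 1 + g) (n - 1)))
       \<and> (Abs_fps (\<lambda>k. of_nat (card (primitive_factorizations n (full_cycle n) k))) :: rat fps) =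
            fps_const (catalan (n - 1)) * fps_X ^ (n - 1) /
              (\<Prod>i = 1..n - 1. 1 - fps_const (of_nat (i ^ 2)) * fps_X ^ 2)"
proof -
  obtain N where n: "n = Suc N"
    using assms by (cases n) auto
  let ?a = "Abs_fps (\<lambda>k. prim_count n k (full_cycle n))"
  let ?E = "\<Prod>i = 1..N. 1 - fps_const (of_nat (i ^ 2)) * fps_X ^ 2 :: rat fps"
  let ?H = "Abs_fps (\<lambda>k. if even k
    then of_nat (complete_homogeneous (k div 2) N (\<lambda>i. i ^ 2)) else 0) :: rat fps"
  have HE: "?H * ?E = 1"
    by (rule central_factorial_gf)
  have aE: "?a * ?E = fps_const (catalan N) * fps_X ^ N"
    unfolding n by (rule full_cycle_gf)
  have "?a = (?a * ?E) * ?H"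
    using HE by (simp only: mult.assoc mult.commute[of ?E] mult_1_right)
  then have a: "?a = fps_const (catalan N) * (?H * fps_X ^ N)"
    unfolding aE by (simp only: mult_ac)
  have "of_nat (card (primitive_factorizations n (full_cycle n) (N + 2 * g))) =
      catalan N * of_nat (central_factorial (N + g) N)" for g
  proof -
    have "of_nat (card (primitive_factorizations n (full_cycle n) (N + 2 * g))) =
        fps_nth ?a (N + 2 * g)"
      by (simp add: prim_count_def)
    \<comment> \<open>Removing z^N leaves the exponent 2g, at which \<open>?H\<close> has the
      coefficient h_g(1^2, ..., N^2) = T(N + g, N).\<close>
    also have "\<dots> = catalan N * of_nat (central_factorial (N + g) N)"
      unfolding a by (simp add: fps_X_power_mult_right_nth central_factorial_def)
    finally show ?thesis .
  qed
  moreover have "?E \<noteq> 0"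
    using HE by (metis mult_zero_right zero_neq_one)
  then have "?a = fps_const (catalan N) * fps_X ^ N / ?E"
    unfolding aE[symmetric] by (rule nonzero_mult_div_cancel_right[symmetric])
  ultimately show ?thesis
    by (simp add: n prim_count_def)
qed

end
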